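(* Let $G$ be a locally compact unimodular amenable topological group and let $T : G \curvearrowright X$ be a continuous action of $G$ on a compact metrizable space $X$. Let $\mu \in \mathcal{M}_T(X)$ be a $T$-invariant Borel probability measure on $X$. Let $(F_i)_{i \in \mathscr{I}}$ be a Følner net for $G$, and let $f \in C(X)$ (complex-valued). Consider the conditions: (1) $f$ is Herman, i.e. the set $\{ \int f \, \mathrm{d}\nu : \nu \in \mathcal{M}_T(X)\}$ is a singleton. (2) For every net $(C_i)_{i \in \mathscr{I}}$ of Borel-measurable subsets of $X$ of positive $\mu$-measure, the net $\left( \alpha_{C_i}\left( \operatorname{Avg}_{F_i} f\right)\right)_{i \in \mathscr{I}}$ converges to $\int f \, \mathrm{d}\mu$. (3) For every net $(U_i)_{i \in \mathscr{I}}$ of open subsets of $X$ of positive $\mu$-measure, the net $\left( \alpha_{U_i}\left( \operatorname{Avg}_{F_i} f\right)\right)_{i \in \mathscr{I}}$ converges to $\int f \, \mathrm{d}\mu$. Then (1)$\Rightarrow$(2)$\Rightarrow$(3), and if $\mu$ is fully supported on $X$ (gives positive measure to every nonempty open set), then (3)$\Rightarrow$(1).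
   Context: $\mathcal{M}_T(X)$ denotes the set of $T$-invariant Borel probability measures on $X$. $m$ is a bi-invariant Haar measure on $G$. For a compact $K \subseteq G$ with $m(K)>0$ and $f \in C(X)$, $\operatorname{Avg}_K f(x) = \frac{1}{m(K)} \int_K f(T_g x) \, \mathrm{d}m(g)$, a continuous function on $X$. For a measurable $C \subseteq X$ with $\mu(C)>0$, $\alpha_C(h) = \frac{1}{\mu(C)} \int_C h \, \mathrm{d}\mu$. A net $(F_i)_{i \in \mathscr{I}}$ of compact subsets of $G$ is Følner if $m(F_i)>0$ for all $i$ and $\lim_i \frac{m(gF_i \,\Delta\, F_i)}{m(F_i)} = 0$ for every $g \in G$. The action convention is $T_{gh} = T_g T_h$. *)

theory Defs
  imports "HOL-Analysis.Analysis" "HOL-Probability.Probability_Measure"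
begin

text \<open>Groups are written additively, since \<^class>\<open>topological_group_add\<close> is the library's class of
  (not necessarily commutative) topological groups: \<open>g + h\<close> stands for the product \<open>gh\<close>, \<open>0\<close> for
  the identity, and \<open>(+) g ` A\<close> for the left translate \<open>gA\<close>.\<close>

definition radon_measure :: "'g::topological_space measure \<Rightarrow> bool" where
  "radon_measure m \<longleftrightarrow>
     sets m = sets borel \<and>
     (\<forall>K. compact K \<longrightarrow> emeasure m K < \<infinity>) \<and>
     (\<forall>A\<in>sets borel. emeasure m A = (INF U\<in>{U. open U \<and> A \<subseteq> U}. emeasure m U)) \<and>
     (\<forall>U. open U \<longrightarrow> emeasure m U = (SUP K\<in>{K. compact K \<and> K \<subseteq> U}. emeasure m K))"

definition left_haar_measure :: "'g::topological_group_add measure \<Rightarrow> bool" where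
  "left_haar_measure m \<longleftrightarrow>
     radon_measure m \<and> emeasure m UNIV \<noteq> 0 \<and>
     (\<forall>g. \<forall>A\<in>sets borel. emeasure m ((+) g ` A) = emeasure m A)"

definition right_haar_measure :: "'g::topological_group_add measure \<Rightarrow> bool" where
  "right_haar_measure m \<longleftrightarrow>
     radon_measure m \<and> emeasure m UNIV \<noteq> 0 \<and>
     (\<forall>g. \<forall>A\<in>sets borel. emeasure m ((\<lambda>x. x + g) ` A) = emeasure m A)"

definition unimodular :: "'g::topological_group_add itself \<Rightarrow> bool" where
  "unimodular _ \<longleftrightarrow> (\<forall>m :: 'g measure. left_haar_measure m \<longrightarrow> right_haar_measure m)"

text \<open>A left-invariant mean on the bounded continuous real functions. For locally compact groups its
  existence is equivalent to that of a left-invariant mean on \<open>L\<^sup>\<infinity>\<close>.\<close>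

definition left_invariant_mean :: "(('g::topological_group_add \<Rightarrow>\<^sub>C real) \<Rightarrow> real) \<Rightarrow> bool" where
  "left_invariant_mean M \<longleftrightarrow>
     linear M \<and>
     (\<forall>\<phi>. (\<forall>x. 0 \<le> apply_bcontfun \<phi> x) \<longrightarrow> 0 \<le> M \<phi>) \<and>
     M (const_bcontfun 1) = 1 \<and>
     (\<forall>g \<phi> \<psi>. (\<forall>x. apply_bcontfun \<psi> x = apply_bcontfun \<phi> (g + x)) \<longrightarrow> M \<psi> = M \<phi>)"

definition amenable :: "'g::topological_group_add itself \<Rightarrow> bool" where
  "amenable _ \<longleftrightarrow> (\<exists>M :: ('g \<Rightarrow>\<^sub>C real) \<Rightarrow> real. left_invariant_mean M)"

definition continuous_action ::
    "('g::topological_group_add \<Rightarrow> 'x::topological_space \<Rightarrow> 'x) \<Rightarrow> bool" where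
  "continuous_action T \<longleftrightarrow>
     T 0 = id \<and> (\<forall>g h. T (g + h) = T g \<circ> T h) \<and>
     continuous_on UNIV (\<lambda>(g, x). T g x)"

definition invariant_measures ::
    "('g \<Rightarrow> 'x::topological_space \<Rightarrow> 'x) \<Rightarrow> 'x measure set" where
  "invariant_measures T =
     {\<nu>. prob_space \<nu> \<and> sets \<nu> = sets borel \<and> (\<forall>g. distr \<nu> borel (T g) = \<nu>)}"

definition herman ::
    "('g \<Rightarrow> 'x::topological_space \<Rightarrow> 'x) \<Rightarrow> ('x \<Rightarrow> complex) \<Rightarrow> bool" where
  "herman T f \<longleftrightarrow> is_singleton {(\<integral>x. f x \<partial>\<nu>) | \<nu>. \<nu> \<in> invariant_measures T}"

text \<open>Nets are indexed by a directed set, given by a carrier \<open>I\<close> and a preorder \<open>le\<close> on it.\<close>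

definition directed_set :: "'i set \<Rightarrow> ('i \<Rightarrow> 'i \<Rightarrow> bool) \<Rightarrow> bool" where
  "directed_set I le \<longleftrightarrow>
     I \<noteq> {} \<and> reflp_on I le \<and> transp_on I le \<and>
     (\<forall>i\<in>I. \<forall>j\<in>I. \<exists>k\<in>I. le i k \<and> le j k)"

text \<open>The filter of tails: \<open>(a \<longlongrightarrow> l) (net_filter I le)\<close> is convergence of the net \<open>(a i)\<close>,
  \<open>i \<in> I\<close>, to \<open>l\<close>.\<close>

definition net_filter :: "'i set \<Rightarrow> ('i \<Rightarrow> 'i \<Rightarrow> bool) \<Rightarrow> 'i filter" where
  "net_filter I le = (INF i\<in>I. principal {j\<in>I. le i j})"

lemma eventually_net_filter:
  assumes "directed_set I le"
  shows "eventually P (net_filter I le) \<longleftrightarrow> (\<exists>i\<in>I. \<forall>j\<in>I. le i j \<longrightarrow> P j)"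
proof -
  have "eventually P (net_filter I le) \<longleftrightarrow> (\<exists>i\<in>I. eventually P (principal {j\<in>I. le i j}))"
    unfolding net_filter_def
  proof (rule eventually_INF_base)
    show "I \<noteq> {}" using assms by (simp add: directed_set_def)
  next
    fix i j assume ij: "i \<in> I" "j \<in> I"
    then obtain k where k: "k \<in> I" "le i k" "le j k"
      using assms by (auto simp: directed_set_def)
    have "transp_on I le" using assms by (simp add: directed_set_def)
    then have "{l\<in>I. le k l} \<subseteq> {l\<in>I. le i l} \<inter> {l\<in>I. le j l}"
      using ij k by (auto dest: transp_onD)
    then show "\<exists>k\<in>I. principal {l\<in>I. le k l} \<le> inf (principal {l\<in>I. le i l}) (principal {l\<in>I. le j l})"
      using k(1) by auto
  qed
  then show ?thesis by (auto simp: eventually_principal)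
qed

definition folner_net ::
    "'g::topological_group_add measure \<Rightarrow> 'i set \<Rightarrow> ('i \<Rightarrow> 'i \<Rightarrow> bool) \<Rightarrow> ('i \<Rightarrow> 'g set) \<Rightarrow> bool" where
  "folner_net m I le F \<longleftrightarrow>
     directed_set I le \<and>
     (\<forall>i\<in>I. compact (F i) \<and> measure m (F i) > 0) \<and>
     (\<forall>g. ((\<lambda>i. measure m (sym_diff ((+) g ` F i) (F i)) / measure m (F i)) \<longlongrightarrow> 0) (net_filter I le))"

definition Avg ::
    "'g measure \<Rightarrow> ('g \<Rightarrow> 'x \<Rightarrow> 'x) \<Rightarrow> 'g set \<Rightarrow> ('x \<Rightarrow> complex) \<Rightarrow> 'x \<Rightarrow> complex" where
  "Avg m T K f x = (1 / measure m K) *\<^sub>R (LINT g:K|m. f (T g x))"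

definition alpha :: "'x measure \<Rightarrow> 'x set \<Rightarrow> ('x \<Rightarrow> complex) \<Rightarrow> complex" where
  "alpha \<mu> C h = (1 / measure \<mu> C) *\<^sub>R (LINT x:C|\<mu>. h x)"

definition fully_supported :: "'x::topological_space measure \<Rightarrow> bool" where
  "fully_supported \<mu> \<longleftrightarrow> (\<forall>U. open U \<longrightarrow> U \<noteq> {} \<longrightarrow> measure \<mu> U > 0)"

text \<open>The spatial-temporal averages of \<open>f\<close> converge to its \<open>\<mu>\<close>-integral along every net of
  members of \<open>\<C>\<close> of positive measure. The nets have the same index set as \<open>F\<close>.\<close>

definition averages_converge ::
    "'g measure \<Rightarrow> ('g \<Rightarrow> 'x \<Rightarrow> 'x) \<Rightarrow> 'x measure \<Rightarrow> 'i set \<Rightarrow> ('i \<Rightarrow> 'i \<Rightarrow> bool) \<Rightarrow>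
     ('i \<Rightarrow> 'g set) \<Rightarrow> ('x \<Rightarrow> complex) \<Rightarrow> 'x set set \<Rightarrow> bool" where
  "averages_converge m T \<mu> I le F f \<C> \<longleftrightarrow>
     (\<forall>C. (\<forall>i\<in>I. C i \<in> \<C> \<and> measure \<mu> (C i) > 0) \<longrightarrow>
       ((\<lambda>i. alpha \<mu> (C i) (Avg m T (F i) f)) \<longlongrightarrow> (\<integral>x. f x \<partial>\<mu>)) (net_filter I le))"

end

theory Submission
  imports Defs
begin

text \<open>(1) \<open>\<Longrightarrow>\<close> (2): if the averages stay away from \<open>\<integral>f d\<mu>\<close> along a subnet, Tychonoff's theorem gives a cluster point
  of the functionals \<open>h \<mapsto> \<alpha>\<^bsub>C\<^sub>i\<^esub>(Avg\<^bsub>F\<^sub>i\<^esub> h)\<close> on \<open>C(X)\<close>. It is positive and normalised, and the Folner property makes it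
  invariant, so by Riesz representation it is integration against an invariant measure whose
  \<open>f\<close>-integral differs from that of \<open>\<mu>\<close>.
  (3) \<open>\<Longrightarrow>\<close> (1): if \<open>\<integral>f d\<nu> \<noteq> \<integral>f d\<mu>\<close>, let \<open>p\<close> be the real part of a suitable multiple of \<open>f\<close> and choose \<open>c\<close> with
  \<open>\<integral>p d\<mu> < c < \<integral>p d\<nu>\<close>. Since \<open>\<integral>Avg\<^bsub>F\<^sub>i\<^esub> p d\<nu> = \<integral>p d\<nu>\<close>, the open sets \<open>{Avg\<^bsub>F\<^sub>i\<^esub> p > c}\<close> are nonempty, and
  the averages over them stay above \<open>c\<close>.\<close>

lemma integrable_continuous_compact:
  fixes h :: "'x::topological_space \<Rightarrow> 'b::{banach, second_countable_topology}"
  assumes "finite_measure M" "sets M = sets borel" "compact (UNIV :: 'x set)" "continuous_on UNIV h"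
  shows "integrable M h"
proof -
  interpret finite_measure M by fact
  have "bounded (h ` UNIV)"
    using compact_continuous_image assms(3,4) by (intro compact_imp_bounded) blast
  then obtain B where "\<And>x. norm (h x) \<le> B" by (auto simp: bounded_iff)
  moreover have "h \<in> borel_measurable M"
    using borel_measurable_continuous_onI[OF assms(4)] assms(2) by (simp cong: measurable_cong_sets)
  ultimately show ?thesis by (intro integrable_const_bound[of _ B]) auto
qed

section \<open>Riesz representation on compact metrizable spaces\<close>

text \<open>\<open>\<phi>\<close> takes arbitrary real functions, but the axioms constrain it only
  on continuous ones. Metrizability enters the construction through \<open>cozero\<close>, which
  supplies the bump functions usually taken from Urysohn's lemma.\<close>

locale positive_functional =
  fixes \<phi> :: "('x::topological_space \<Rightarrow> real) \<Rightarrow> real"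
  assumes compact_space: "compact (UNIV :: 'x set)"
    and cozero: "\<And>U::'x set. open U \<Longrightarrow>
      \<exists>d::'x \<Rightarrow> real. continuous_on UNIV d \<and> (\<forall>x. 0 \<le> d x) \<and> U = {x. 0 < d x}"
    and add: "\<And>a b. continuous_on UNIV a \<Longrightarrow> continuous_on UNIV b \<Longrightarrow>
      \<phi> (\<lambda>x. a x + b x) = \<phi> a + \<phi> b"
    and scale: "\<And>a c. continuous_on UNIV a \<Longrightarrow> \<phi> (\<lambda>x. c * a x) = c * \<phi> a"
    and nonneg: "\<And>a. continuous_on UNIV a \<Longrightarrow> (\<And>x. 0 \<le> a x) \<Longrightarrow> 0 \<le> \<phi> a"
    and one: "\<phi> (\<lambda>_. 1) = 1"
begin

lemma const: "\<phi> (\<lambda>_. c) = c"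
  using scale[of "\<lambda>_. 1" c] one by simp

lemma mono:
  assumes "continuous_on UNIV a" "continuous_on UNIV b" "\<And>x. a x \<le> b x"
  shows "\<phi> a \<le> \<phi> b"
proof -
  have c: "continuous_on UNIV (\<lambda>x. b x + (-1) * a x)"
    using assms by (intro continuous_intros)
  have "0 \<le> \<phi> (\<lambda>x. b x + (-1) * a x)"
    by (rule nonneg[OF c]) (simp add: assms)
  also have "\<dots> = \<phi> b - \<phi> a"
    using assms by (subst add) (auto intro!: continuous_intros simp: scale[of a "-1", simplified])
  finally show ?thesis by simp
qed

lemma sum:
  assumes "finite S" "\<And>i. i \<in> S \<Longrightarrow> continuous_on UNIV (a i)"
  shows "\<phi> (\<lambda>x. \<Sum>i\<in>S. a i x) = (\<Sum>i\<in>S. \<phi> (a i))"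
  using assms
proof (induction S rule: finite_induct)
  case empty
  show ?case by (simp add: const)
next
  case (insert j S)
  have "\<phi> (\<lambda>x. a j x + (\<Sum>i\<in>S. a i x)) = \<phi> (a j) + \<phi> (\<lambda>x. \<Sum>i\<in>S. a i x)"
    using insert.prems by (intro add continuous_on_sum) auto
  then show ?case using insert by simp
qed

section \<open>The outer measure generated by a positive functional\<close>

definition below :: "'x set \<Rightarrow> ('x \<Rightarrow> real) set" where
  "below U = {h. continuous_on UNIV h \<and> (\<forall>x. 0 \<le> h x \<and> h x \<le> indicator U x)}"

definition open_content :: "'x set \<Rightarrow> ennreal" where
  "open_content U = (SUP h\<in>below U. ennreal (\<phi> h))"

definition outer :: "'x set \<Rightarrow> ennreal" where
  "outer A = (INF U\<in>{U. open U \<and> A \<subseteq> U}. open_content U)"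

lemma belowD:
  assumes "h \<in> below U"
  shows "continuous_on UNIV h" "0 \<le> h x" "h x \<le> 1" "x \<notin> U \<Longrightarrow> h x = 0"
  using assms unfolding below_def
  by (auto simp: indicator_def order_antisym split: if_splits dest!: spec[of _ x]
      intro: order_trans[of "h x" "of_bool (x \<in> U)" 1])

lemma belowI:
  assumes "continuous_on UNIV h" "\<And>x. 0 \<le> h x" "\<And>x. h x \<le> 1" "\<And>x. x \<notin> U \<Longrightarrow> h x = 0"
  shows "h \<in> below U"
  using assms unfolding below_def by (auto simp: indicator_def)

lemma zero_below: "(\<lambda>_. 0) \<in> below U"
  by (rule belowI) auto

lemma below_le_open_content: "h \<in> below U \<Longrightarrow> ennreal (\<phi> h) \<le> open_content U"
  unfolding open_content_def by (rule SUP_upper)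

lemma open_content_mono: "U \<subseteq> V \<Longrightarrow> open_content U \<le> open_content V"
  unfolding open_content_def
  by (rule SUP_subset_mono) (auto intro!: belowI dest: belowD)

lemma outer_open: "open U \<Longrightarrow> outer U = open_content U"
  unfolding outer_def by (intro antisym INF_greatest INF_lower) (auto intro: open_content_mono)

lemma outer_mono: "A \<subseteq> B \<Longrightarrow> outer A \<le> outer B"
  unfolding outer_def by (rule INF_superset_mono) auto

lemma open_content_empty: "open_content {} = 0"
proof -
  have "\<phi> h = 0" if "h \<in> below {}" for h
  proof -
    have "h = (\<lambda>_. 0)" using belowD(4)[OF that] by auto
    then show ?thesis using const[of 0] by simp
  qed
  then show ?thesis
    unfolding open_content_def by (auto intro!: antisym SUP_least)
qed

lemma open_content_UNIV: "open_content UNIV = 1"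
proof (rule antisym)
  show "open_content UNIV \<le> 1"
    unfolding open_content_def
  proof (rule SUP_least)
    fix h assume h: "h \<in> below UNIV"
    have "\<phi> h \<le> \<phi> (\<lambda>_. 1)" using belowD[OF h] by (intro mono) auto
    then show "ennreal (\<phi> h) \<le> 1" by (simp add: one)
  qed
  have "(\<lambda>_. 1) \<in> below UNIV" by (rule belowI) auto
  from below_le_open_content[OF this] show "1 \<le> open_content UNIV" by (simp add: one)
qed

text \<open>Lowering \<open>h\<close> by \<open>e\<close> costs at most \<open>e\<close> because
  \<open>\<phi>\<close> sends the constant 1 to 1. Members of \<open>below U\<close> need only
  vanish off \<open>U\<close>, with no condition on the closure of their support; truncation
  supplies the missing margin in \<open>open_content_split\<close>.\<close>

lemma \<phi>_truncate:
  assumes "continuous_on UNIV h"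
  shows "\<phi> h \<le> \<phi> (\<lambda>x. max 0 (h x - e)) + e"
proof -
  have "\<phi> h \<le> \<phi> (\<lambda>x. max 0 (h x - e) + e)"
    using assms by (intro mono) (auto intro!: continuous_intros)
  also have "\<dots> = \<phi> (\<lambda>x. max 0 (h x - e)) + e"
    using assms by (subst add) (auto intro!: continuous_intros simp: const)
  finally show ?thesis .
qed

text \<open>The set \<open>{x. e \<le> h x}\<close> is compact, and on it \<open>h\<close> is
  dominated by a finite sum of test functions for the \<open>U n\<close>; elsewhere \<open>h\<close>
  is below \<open>e\<close>. Hence \<open>\<phi> h\<close> exceeds a finite partial sum by at most
  \<open>e\<close>.\<close>

lemma open_content_UN:
  fixes U :: "nat \<Rightarrow> 'x set"
  assumes U: "\<And>n. open (U n)"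
  shows "open_content (\<Union>n. U n) \<le> (\<Sum>n. open_content (U n))"
  unfolding open_content_def[of "\<Union>n. U n"]
proof (rule SUP_least, rule ennreal_le_epsilon)
  fix h and e :: real assume h: "h \<in> below (\<Union>n. U n)" and e: "0 < e"
  note h_cont = belowD(1)[OF h]
  have "\<exists>d. \<forall>n. continuous_on UNIV (d n) \<and> (\<forall>x. (0::real) \<le> d n x) \<and> U n = {x. 0 < d n x}"
    using cozero[OF U] by (intro choice) blast
  then obtain d :: "nat \<Rightarrow> 'x \<Rightarrow> real" where d: "\<And>n. continuous_on UNIV (d n)" "\<And>n x. 0 \<le> d n x"
    "\<And>n. U n = {x. 0 < d n x}" by blast
  \<comment> \<open>The index \<open>k\<close> bounds the sets used and is also the steepness
    factor, so the \<open>V k\<close> increase and a single \<open>k\<close> remains after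
    compactness.\<close>
  define V where "V k = (\<Union>n\<in>{..k}. {x. 1 < real k * d n x})" for k :: nat
  have V_open: "open (V k)" for k
    unfolding V_def by (intro open_UN ballI open_Collect_less continuous_intros d)
  have V_mono: "V k \<subseteq> V l" if "k \<le> l" for k l
  proof
    fix x assume "x \<in> V k"
    then obtain n where n: "n \<le> k" "1 < real k * d n x" by (auto simp: V_def)
    have "real k * d n x \<le> real l * d n x" using that d(2) by (intro mult_right_mono) auto
    then show "x \<in> V l" using n that unfolding V_def by (intro UN_I[of n]) auto
  qed
  let ?K = "{x. e \<le> h x}"
  have "closed ?K" by (intro closed_Collect_le continuous_intros h_cont)
  then have "compact ?K" using compact_space by (metis compact_Int_closed inf_top_left)
  moreover have "?K \<subseteq> (\<Union>k\<in>UNIV. V k)"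
  proof
    fix x assume "x \<in> ?K"
    then have "x \<in> (\<Union>n. U n)" using belowD(4)[OF h, of x] e by force
    then obtain n where n: "0 < d n x" by (auto simp: d(3))
    obtain k0 :: nat where "1 < real k0 * d n x" using reals_Archimedean3[OF n] by blast
    moreover have "real k0 * d n x \<le> real (max n k0) * d n x"
      using n by (intro mult_right_mono) auto
    ultimately have "x \<in> V (max n k0)" unfolding V_def by (intro UN_I[of n]) auto
    then show "x \<in> (\<Union>k\<in>UNIV. V k)" by blast
  qed
  ultimately obtain D where D: "finite D" "?K \<subseteq> (\<Union>k\<in>D. V k)"
    by (rule compactE_image[OF _ V_open]) auto
  obtain k where k: "\<And>l. l \<in> D \<Longrightarrow> l \<le> k" using D(1) finite_nat_set_iff_bounded_le by auto
  have K: "?K \<subseteq> V k" using D(2) V_mono[OF k] by blast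
  \<comment> \<open>On \<open>V k\<close> at least one of \<open>g 0\<close>, ...,
    \<open>g k\<close> equals 1, an upper bound for \<open>h\<close>.\<close>
  define g where "g n x = min 1 (real k * d n x)" for n x
  have g: "g n \<in> below (U n)" for n
  proof (rule belowI)
    show "continuous_on UNIV (g n)" unfolding g_def by (intro continuous_intros d)
    show "g n x = 0" if "x \<notin> U n" for x
      using that d(2)[of n x] by (simp add: g_def d(3) antisym)
  qed (auto simp: g_def d)
  have g_cont: "continuous_on UNIV (\<lambda>x. \<Sum>n\<le>k. g n x)"
    by (intro continuous_intros belowD[OF g])
  have le: "h x \<le> (\<Sum>n\<le>k. g n x) + e" for x
  proof (cases "x \<in> ?K")
    case True
    then obtain n where n: "n \<le> k" "1 < real k * d n x" using K by (auto simp: V_def)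
    then have "h x \<le> g n x" using belowD(3)[OF h, of x] by (simp add: g_def)
    also have "\<dots> \<le> (\<Sum>n\<le>k. g n x)" using n(1) belowD(2)[OF g] by (intro member_le_sum) auto
    finally show ?thesis using e by simp
  next
    case False
    moreover have "0 \<le> (\<Sum>n\<le>k. g n x)" using belowD(2)[OF g] by (intro sum_nonneg)
    ultimately show ?thesis by simp
  qed
  have "\<phi> h \<le> \<phi> (\<lambda>x. (\<Sum>n\<le>k. g n x) + e)"
    using le by (intro mono h_cont continuous_intros g_cont)
  also have "\<dots> = (\<Sum>n\<le>k. \<phi> (g n)) + e"
    using g_cont belowD(1)[OF g] by (simp add: add const sum)
  finally have "ennreal (\<phi> h) \<le> ennreal ((\<Sum>n\<le>k. \<phi> (g n)) + e)" by (rule ennreal_leI)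
  also have "\<dots> = (\<Sum>n\<le>k. ennreal (\<phi> (g n))) + ennreal e"
  proof -
    have "0 \<le> \<phi> (g n)" for n by (intro nonneg belowD[OF g])
    then show ?thesis using e by (simp add: sum_nonneg ennreal_plus sum_ennreal)
  qed
  also have "\<dots> \<le> (\<Sum>n\<le>k. open_content (U n)) + ennreal e"
    by (intro add_right_mono sum_mono below_le_open_content g)
  also have "\<dots> \<le> (\<Sum>n. open_content (U n)) + ennreal e"
    by (intro add_right_mono sum_le_suminf) auto
  finally show "ennreal (\<phi> h) \<le> (\<Sum>n. open_content (U n)) + ennreal e" .
qed

text \<open>This is Caratheodory's inequality with an open test set \<open>V\<close>. Take
  \<open>h\<close> below \<open>V \<inter> U\<close> and \<open>g\<close> below
  \<open>V \<inter> {x. h x < e}\<close>, an open set containing \<open>V - U\<close>: once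
  \<open>h\<close> is truncated at \<open>e\<close>, their sum is below \<open>V\<close>.\<close>

lemma open_content_split:
  assumes "open U" "open V"
  shows "open_content (V \<inter> U) + outer (V - U) \<le> open_content V"
proof -
  have "open_content (V \<inter> U) + outer (V - U) = (SUP h\<in>below (V \<inter> U). ennreal (\<phi> h) + outer (V - U))"
    unfolding open_content_def using zero_below by (subst ennreal_SUP_add_left) auto
  also have "\<dots> \<le> open_content V"
  proof (rule SUP_least, rule ennreal_le_epsilon)
    fix h and e :: real assume h: "h \<in> below (V \<inter> U)" and e: "0 < e"
    note h_cont = belowD(1)[OF h]
    let ?W = "V \<inter> {x. h x < e}"
    have "open ?W" by (intro open_Int assms open_Collect_less continuous_intros h_cont)
    then have "outer (V - U) \<le> open_content ?W"
      using belowD(4)[OF h] e unfolding outer_def by (intro INF_lower) auto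
    then have "ennreal (\<phi> h) + outer (V - U) \<le> ennreal (\<phi> h) + open_content ?W"
      by (rule add_left_mono)
    also have "\<dots> = (SUP g\<in>below ?W. ennreal (\<phi> h) + ennreal (\<phi> g))"
      unfolding open_content_def using zero_below by (subst ennreal_SUP_add_right) auto
    also have "\<dots> \<le> open_content V + ennreal e"
    proof (rule SUP_least)
      fix g assume g: "g \<in> below ?W"
      \<comment> \<open>Where \<open>g\<close> is nonzero, \<open>h\<close> is below
        \<open>e\<close> and the truncated part is 0. The two summands never overlap, so the sum
        stays at most 1.\<close>
      let ?k = "\<lambda>x. max 0 (h x - e) + g x"
      have kc: "continuous_on UNIV (\<lambda>x. max 0 (h x - e))" by (intro continuous_intros h_cont)
      have k: "?k \<in> below V"
      proof (rule belowI)
        show "continuous_on UNIV ?k" by (intro continuous_intros h_cont belowD(1)[OF g])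
        fix x
        show "0 \<le> ?k x" using belowD(2)[OF g, of x] by simp
        show "?k x \<le> 1"
          using belowD(3)[OF g, of x] belowD(3)[OF h, of x] belowD(4)[OF g, of x] e
          by (cases "h x < e") auto
        show "?k x = 0" if "x \<notin> V"
          using belowD(4)[OF g, of x] belowD(4)[OF h, of x] that e by auto
      qed
      have "\<phi> h + \<phi> g \<le> \<phi> ?k + e"
        using \<phi>_truncate[OF h_cont, of e] add[OF kc belowD(1)[OF g]] by simp
      then have "ennreal (\<phi> h + \<phi> g) \<le> ennreal (\<phi> ?k + e)" by (rule ennreal_leI)
      then have "ennreal (\<phi> h) + ennreal (\<phi> g) \<le> ennreal (\<phi> ?k) + ennreal e"
        using belowD[OF g] belowD[OF h] belowD[OF k] e by (simp add: ennreal_plus nonneg)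
      also have "\<dots> \<le> open_content V + ennreal e"
        by (intro add_right_mono below_le_open_content k)
      finally show "ennreal (\<phi> h) + ennreal (\<phi> g) \<le> open_content V + ennreal e" .
    qed
    finally show "ennreal (\<phi> h) + outer (V - U) \<le> open_content V + ennreal e" .
  qed
  finally show ?thesis .
qed

text \<open>Open supersets with excess \<open>e * (1/2)^Suc n\<close> carry countable subadditivity
  over from \<open>open_content_UN\<close>.\<close>

lemma outer_UN: "outer (\<Union>n::nat. A n) \<le> (\<Sum>n. outer (A n))"
proof (rule ennreal_le_epsilon)
  fix e :: real assume fin: "(\<Sum>n. outer (A n)) < top" and e: "0 < e"
  have "\<exists>U. open U \<and> A n \<subseteq> U \<and> open_content U \<le> outer (A n) + ennreal (e * (1/2)^Suc n)" for n
  proof -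
    \<comment> \<open>Finiteness makes adding a positive amount a strict increase, so some open
      superset has content below the enlarged infimum.\<close>
    have "outer (A n) < top" using fin by (metis ennreal_suminf_lessD)
    moreover have "0 < ennreal (e * (1/2)^Suc n)" using e by simp
    ultimately have "outer (A n) < outer (A n) + ennreal (e * (1/2)^Suc n)"
      by (metis ennreal_add_left_cancel_less add.right_neutral top.not_eq_extremum infinity_ennreal_def)
    then show ?thesis unfolding outer_def[of "A n"] INF_less_iff by (auto intro: less_imp_le)
  qed
  then obtain U where U: "\<And>n. open (U n)" "\<And>n. A n \<subseteq> U n"
    "\<And>n. open_content (U n) \<le> outer (A n) + ennreal (e * (1/2)^Suc n)" by metis
  have "outer (\<Union>n. A n) \<le> outer (\<Union>n. U n)" using U(2) by (intro outer_mono) blast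
  also have "\<dots> = open_content (\<Union>n. U n)" using U(1) by (intro outer_open) auto
  also have "\<dots> \<le> (\<Sum>n. open_content (U n))" by (rule open_content_UN) fact
  also have "\<dots> \<le> (\<Sum>n. outer (A n) + ennreal (e * (1/2)^Suc n))"
    by (intro suminf_le U(3)) auto
  also have "\<dots> = (\<Sum>n. outer (A n)) + (\<Sum>n. ennreal (e * (1/2)^Suc n))"
    by (rule suminf_add[symmetric]) auto
  also have "(\<Sum>n. ennreal (e * (1/2)^Suc n)) = ennreal e"
    using e sums_mult[OF power_half_series, of e] by (intro suminf_ennreal_eq) auto
  finally show "outer (\<Union>n. A n) \<le> (\<Sum>n. outer (A n)) + ennreal e" .
qed

lemma outer_measure_space_outer: "outer_measure_space UNIV outer"
  using outer_UN outer_open[of "{}"] open_content_empty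
  by (simp add: outer_measure_space_def positive_def increasing_def countably_subadditive_def outer_mono)

lemma outer_Un: "outer (A \<union> B) \<le> outer A + outer B"
proof -
  have "countably_subadditive (Pow UNIV) outer" "positive (Pow UNIV) outer"
    using outer_measure_space_outer by (auto simp: outer_measure_space_def)
  moreover have "ring_of_sets UNIV (Pow (UNIV::'x set))"
    using sigma_algebra_Pow[of "UNIV :: 'x set"] by (simp add: sigma_algebra_def algebra_def)
  ultimately have "subadditive (Pow UNIV) outer"
    by (metis ring_of_sets.countably_subadditive_subadditive)
  from subadditiveD[OF this, of A "B - A"] have "outer (A \<union> B) \<le> outer A + outer (B - A)" by simp
  also have "\<dots> \<le> outer A + outer B" by (intro add_left_mono outer_mono) auto
  finally show ?thesis .
qed

text \<open>Caratheodory measurability for an arbitrary test set \<open>A\<close> follows from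
  \<open>open_content_split\<close> by taking the infimum over open
  \<open>V \<supseteq> A\<close>.\<close>

lemma open_in_lambda_system:
  assumes U: "open U"
  shows "U \<in> lambda_system UNIV (Pow UNIV) outer"
proof -
  have "outer (A \<inter> U) + outer (A - U) = outer A" for A
  proof (rule antisym)
    have "A = A \<inter> U \<union> (A - U)" by auto
    then show "outer A \<le> outer (A \<inter> U) + outer (A - U)" using outer_Un by metis
    show "outer (A \<inter> U) + outer (A - U) \<le> outer A"
      unfolding outer_def[of A]
    proof (rule INF_greatest)
      fix V assume "V \<in> {V. open V \<and> A \<subseteq> V}"
      then have V: "open V" "A \<subseteq> V" by auto
      have "outer (A \<inter> U) + outer (A - U) \<le> outer (V \<inter> U) + outer (V - U)"
        using V by (intro add_mono outer_mono) auto
      also have "\<dots> \<le> open_content V"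
        using open_content_split[OF U V(1)] by (simp add: outer_open[OF open_Int[OF V(1) U]])
      finally show "outer (A \<inter> U) + outer (A - U) \<le> open_content V" .
    qed
  qed
  moreover have "(UNIV - U) \<inter> A = A - U" "U \<inter> A = A \<inter> U" for A by auto
  ultimately show ?thesis by (simp add: lambda_system_def)
qed

section \<open>The representing measure and its integrals\<close>

definition rep :: "'x measure" where
  "rep = measure_of UNIV (sets borel) outer"

lemma sets_rep [simp, measurable_cong]: "sets rep = sets borel"
  unfolding rep_def by (simp add: sets.sigma_sets_eq[of borel, simplified])

lemma space_rep [simp]: "space rep = UNIV"
  using sets_eq_imp_space_eq[OF sets_rep] by simp

text \<open>\<open>measure_of\<close> takes the values of \<open>outer\<close> only once countable
  additivity is known. Caratheodory's lemma gives it on the lambda system, which contains the open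
  sets and therefore all Borel sets.\<close>

lemma emeasure_rep:
  assumes "A \<in> sets borel"
  shows "emeasure rep A = outer A"
proof -
  interpret P: sigma_algebra UNIV "Pow (UNIV :: 'x set)" by (rule sigma_algebra_Pow)
  let ?L = "lambda_system UNIV (Pow UNIV) outer"
  have ms: "measure_space UNIV ?L outer"
    using outer_measure_space_outer by (intro P.caratheodory_lemma) simp
  have sub: "sets borel \<subseteq> ?L"
    unfolding borel_def sets_measure_of[OF subset_UNIV[of "Collect open", folded Pow_UNIV]]
    by (rule sigma_algebra.sigma_sets_subset)
       (use ms open_in_lambda_system in \<open>auto simp: measure_space_def\<close>)
  have "countably_additive (sets borel) outer"
    using ms sub unfolding measure_space_def countably_additive_def by (meson subset_trans subsetD)
  then show ?thesis
    unfolding rep_def using assms ms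
    by (intro emeasure_measure_of_sigma)
       (auto simp: measure_space_def positive_def sets.sigma_algebra_axioms[of borel, simplified])
qed

lemma prob_space_rep: "prob_space rep"
  by (rule prob_spaceI) (simp add: emeasure_rep outer_open open_content_UNIV)

lemma measure_rep_UNIV [simp]: "measure rep UNIV = 1"
  using prob_space.prob_space[OF prob_space_rep] by simp

lemma below_le_rep:
  assumes "h \<in> below U" "open U"
  shows "\<phi> h \<le> measure rep U"
proof -
  interpret prob_space rep by (rule prob_space_rep)
  have "ennreal (\<phi> h) \<le> emeasure rep U"
    using below_le_open_content assms by (simp add: emeasure_rep outer_open)
  then show ?thesis by (simp add: emeasure_eq_measure)
qed

lemma integrable_continuous:
  fixes h :: "'x \<Rightarrow> real"
  assumes "continuous_on UNIV h"
  shows "integrable rep h"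
  using prob_space_rep compact_space assms
  by (intro integrable_continuous_compact) (auto simp: prob_space.finite_measure)

text \<open>\<open>below_le_rep\<close> bounds \<open>\<phi>\<close> on each layer of
  \<open>h\<close> by the measure of an open superlevel set; with \<open>n\<close> layers the total
  error is \<open>1 / n\<close>.\<close>

lemma \<phi>_le_integral:
  assumes h: "continuous_on UNIV h" "\<And>x. 0 \<le> h x" "\<And>x. h x \<le> 1"
  shows "\<phi> h \<le> (\<integral>x. h x \<partial>rep)"
proof (rule field_le_epsilon)
  interpret prob_space rep by (rule prob_space_rep)
  fix e :: real assume "0 < e"
  then obtain n :: nat where n: "1 / e < real n" using reals_Archimedean2 by blast
  then have n0: "0 < real n" using \<open>0 < e\<close> by (meson less_trans zero_less_divide_1_iff)
  \<comment> \<open>Layer-cake decomposition: \<open>n h = \<Sum>\<^sub>k t\<^sub>k\<close> with \<open>t\<^sub>k\<close> supported in \<open>W\<^sub>k\<close>, and \<open>\<Sum>\<^sub>k 1\<^bsub>W\<^sub>k\<^esub> \<le> n h + 1\<close>.\<close>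
  define t where "t k x = min 1 (max 0 (real n * h x - real k))" for k x
  define W where "W k = {x. real k < real n * h x}" for k
  have W: "open (W k)" for k
    unfolding W_def by (intro open_Collect_less continuous_intros h)
  have t: "t k \<in> below (W k)" for k
    by (rule belowI) (auto simp: t_def W_def intro!: continuous_intros h)
  \<comment> \<open>The terms cut \<open>[0, y]\<close> at the integers; the outer minimum records
    that only \<open>N\<close> slices are taken.\<close>
  have slice: "(\<Sum>k<N. min 1 (max 0 (y - real k))) = min (real N) y" if "0 \<le> y" for y :: real and N
    using that by (induction N) auto
  \<comment> \<open>There can be up to \<open>y + 1\<close> naturals \<open>k < y\<close>, which is
    the source of the surplus 1. The minimum with \<open>N\<close> is there to make the induction go
    through.\<close>
  have count: "(\<Sum>k<N. if real k < y then 1 else 0) \<le> min (real N) (y + 1)" if "0 \<le> y" for y :: real and N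
    using that by (induction N) (auto simp: min_def split: if_splits)
  have "real n * h x = (\<Sum>k<n. t k x)" for x
    using slice[of "real n * h x" n] h(2)[of x] mult_left_mono[OF h(3)[of x], of "real n"]
    by (simp add: t_def min_def)
  then have "real n * \<phi> h = \<phi> (\<lambda>x. \<Sum>k<n. t k x)"
    using scale[OF h(1), of "real n"] by simp
  also have "\<dots> = (\<Sum>k<n. \<phi> (t k))" using belowD(1)[OF t] by (intro sum) auto
  also have "\<dots> \<le> (\<Sum>k<n. measure rep (W k))" by (intro sum_mono below_le_rep t W)
  also have "\<dots> = (\<integral>x. (\<Sum>k<n. indicator (W k) x) \<partial>rep)"
    using W by (subst Bochner_Integration.integral_sum) (auto simp: emeasure_eq_measure)
  also have "\<dots> \<le> (\<integral>x. real n * h x + 1 \<partial>rep)"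
  proof (rule integral_mono)
    show "integrable rep (\<lambda>x. \<Sum>k<n. indicator (W k) x :: real)"
      using W by (auto simp: emeasure_eq_measure)
    show "integrable rep (\<lambda>x. real n * h x + 1)"
      by (intro integrable_continuous continuous_intros h)
    show "(\<Sum>k<n. indicator (W k) x) \<le> real n * h x + 1" for x
      using count[of "real n * h x" n] h(2)[of x] by (simp add: W_def indicator_def of_bool_def del: sum.inter_filter)
  qed
  also have "\<dots> = real n * (\<integral>x. h x \<partial>rep) + 1"
    using integrable_continuous[OF h(1)] by (simp)
  finally have "real n * \<phi> h \<le> real n * (\<integral>x. h x \<partial>rep) + 1" .
  then have "\<phi> h \<le> (\<integral>x. h x \<partial>rep) + 1 / real n" using n0 by (simp add: field_simps)
  also have "1 / real n \<le> e" using n n0 \<open>0 < e\<close> by (simp add: field_simps)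
  finally show "\<phi> h \<le> (\<integral>x. h x \<partial>rep) + e" by simp
qed

text \<open>Applying \<open>\<phi>_le_integral\<close> to \<open>a\<close> and to
  \<open>1 - a\<close> gives both inequalities for values in the unit interval. An affine change of
  values brings any bounded \<open>h\<close> there.\<close>

theorem integral_rep:
  assumes h: "continuous_on UNIV h"
  shows "(\<integral>x. h x \<partial>rep) = \<phi> h"
proof -
  interpret prob_space rep by (rule prob_space_rep)
  have unit: "(\<integral>x. a x \<partial>rep) = \<phi> a"
    if a: "continuous_on UNIV a" "\<And>x. 0 \<le> a x" "\<And>x. a x \<le> 1" for a
  proof (rule antisym)
    have "\<phi> (\<lambda>x. 1 + (-1) * a x) \<le> (\<integral>x. 1 + (-1) * a x \<partial>rep)"
      using a by (intro \<phi>_le_integral) (auto intro!: continuous_intros)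
    moreover have "\<phi> (\<lambda>x. 1 + (-1) * a x) = 1 - \<phi> a"
      using a by (subst add) (auto intro!: continuous_intros simp: scale[of a "-1", simplified] const)
    moreover have "(\<integral>x. 1 + (-1) * a x \<partial>rep) = 1 - (\<integral>x. a x \<partial>rep)"
      using integrable_continuous[OF a(1)] by (simp)
    ultimately show "(\<integral>x. a x \<partial>rep) \<le> \<phi> a" by simp
    show "\<phi> a \<le> (\<integral>x. a x \<partial>rep)" using a by (rule \<phi>_le_integral)
  qed
  have "bounded (h ` UNIV)"
    using compact_continuous_image[OF h compact_space] by (rule compact_imp_bounded)
  then obtain B where B: "0 < B" "\<And>x. norm (h x) \<le> B" by (auto simp: bounded_pos)
  let ?a = "\<lambda>x. 1 / 2 + 1 / (2 * B) * h x"
  have "(\<integral>x. ?a x \<partial>rep) = \<phi> ?a"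
  proof (rule unit)
    show "continuous_on UNIV ?a" by (intro continuous_intros h)
    show "0 \<le> ?a x" "?a x \<le> 1" for x
      using B(1) B(2)[of x] by (auto simp: field_simps abs_le_iff)
  qed
  moreover have "\<phi> ?a = 1 / 2 + 1 / (2 * B) * \<phi> h"
    using add[of "\<lambda>_. 1 / 2" "\<lambda>x. 1 / (2 * B) * h x"] scale[OF h, of "1 / (2 * B)"] const
    by (simp add: continuous_intros h del: times_divide_eq_left)
  moreover have "(\<integral>x. ?a x \<partial>rep) = 1 / 2 + 1 / (2 * B) * (\<integral>x. h x \<partial>rep)"
    using integrable_continuous[OF h] by (simp)
  ultimately show ?thesis using B(1) by simp
qed

end

section \<open>Measures, functionals and means\<close>

text \<open>The witness is the distance to the complement of \<open>U\<close>, which is 1-Lipschitz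
  and positive exactly on \<open>U\<close>. The case \<open>U = UNIV\<close> is separate because its
  infimum would range over the empty set.\<close>

lemma metrizable_space_cozero:
  fixes U :: "'x::topological_space set"
  assumes "metrizable_space (euclidean :: 'x topology)" "open U"
  shows "\<exists>d::'x \<Rightarrow> real. continuous_on UNIV d \<and> (\<forall>x. 0 \<le> d x) \<and> U = {x. 0 < d x}"
proof (cases "U = UNIV")
  case True
  then show ?thesis by (intro exI[of _ "\<lambda>_. 1"]) auto
next
  case False
  obtain M D where "Metric_space M D" and top: "(euclidean :: 'x topology) = Metric_space.mtopology M D"
    using assms(1) by (auto simp: metrizable_space_def)
  interpret Metric_space M D by fact
  have M: "M = UNIV" using topspace_mtopology by (simp flip: top)
  have ball_open: "open (mball x r)" for x r
    using openin_mball[of x r] by (simp flip: top)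
  define d where "d x = (INF y\<in>-U. D x y)" for x
  have bdd: "bdd_below (D x ` (-U))" for x by (rule bdd_belowI[of _ 0]) auto
  have lip: "d x \<le> D x y + d y" for x y
  proof -
    have "d x - D x y \<le> D y z" if "z \<in> -U" for z
    proof -
      have "d x \<le> D x z" unfolding d_def using that by (intro cINF_lower bdd) auto
      also have "\<dots> \<le> D x y + D y z" using M by (intro triangle) auto
      finally show ?thesis by simp
    qed
    then have "d x - D x y \<le> d y" unfolding d_def[of y] using False by (intro cINF_greatest) auto
    then show ?thesis by simp
  qed
  have "continuous_on UNIV d"
    unfolding continuous_on_def
  proof (intro ballI tendstoI)
    fix x and e :: real assume "0 < e"
    have "dist (d y) (d x) < e" if "y \<in> mball x e" for y
      using lip[of x y] lip[of y x] that commute[of x y] by (auto simp: dist_real_def)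
    moreover have "x \<in> mball x e" using \<open>0 < e\<close> M by (metis UNIV_I centre_in_mball_iff)
    ultimately show "eventually (\<lambda>y. dist (d y) (d x) < e) (at x)"
      unfolding eventually_at_topological using ball_open by blast
  qed
  moreover have nn: "0 \<le> d x" for x
    unfolding d_def using False by (intro cINF_greatest) auto
  moreover have "x \<in> U \<longleftrightarrow> 0 < d x" for x
  proof
    assume "x \<in> U"
    moreover have "openin mtopology U" using assms(2) by (simp flip: top)
    ultimately obtain r where r: "0 < r" "mball x r \<subseteq> U" by (meson openin_mtopology)
    have "r \<le> D x y" if "y \<in> -U" for y
      using r that M by (metis ComplD UNIV_I in_mball not_le subsetD)
    then have "r \<le> d x" unfolding d_def using False by (intro cINF_greatest) auto
    then show "0 < d x" using r by simp
  next
    assume "0 < d x"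
    moreover have "d x \<le> D x x" if "x \<notin> U"
      unfolding d_def using that by (intro cINF_lower bdd) auto
    ultimately show "x \<in> U" using M by auto
  qed
  ultimately show ?thesis by (intro exI[of _ d]) auto
qed

text \<open>The indicator of an open set is the pointwise limit of the continuous functions
  \<open>min 1 (n * d x)\<close>, so dominated convergence yields equality on open sets, an
  intersection-stable generator of the Borel sets.\<close>

lemma prob_measure_eqI_continuous:
  fixes M N :: "'x::topological_space measure"
  assumes M: "prob_space M" "sets M = sets borel" and N: "prob_space N" "sets N = sets borel"
    and cozero: "\<And>U::'x set. open U \<Longrightarrow>
      \<exists>d::'x \<Rightarrow> real. continuous_on UNIV d \<and> (\<forall>x. 0 \<le> d x) \<and> U = {x. 0 < d x}"
    and eq: "\<And>h::'x \<Rightarrow> real. continuous_on UNIV h \<Longrightarrow> (\<integral>x. h x \<partial>M) = (\<integral>x. h x \<partial>N)"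
  shows "M = N"
proof (rule measure_eqI_generator_eq[where E = "Collect open" and \<Omega> = UNIV and A = "\<lambda>_. UNIV"])
  interpret M: prob_space M by fact
  interpret N: prob_space N by fact
  show "sets M = sigma_sets UNIV (Collect open)" "sets N = sigma_sets UNIV (Collect open)"
    using M N by (simp_all add: borel_def)
  show "emeasure M UNIV \<noteq> \<infinity>" by simp
  show "Int_stable (Collect (open :: 'x set \<Rightarrow> bool))" by (auto simp: Int_stable_def)
  fix U :: "'x set" assume "U \<in> Collect open"
  then have U: "open U" by simp
  then obtain d :: "'x \<Rightarrow> real" where d: "continuous_on UNIV d" "\<And>x. 0 \<le> d x" "U = {x. 0 < d x}"
    using cozero by metis
  define a where "a n x = min 1 (real n * d x)" for n x
  have a: "continuous_on UNIV (a n)" for n unfolding a_def by (intro continuous_intros d)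
  have lim: "(\<lambda>n. a n x) \<longlonglongrightarrow> indicator U x" for x
  proof (cases "x \<in> U")
    case True
    then have "0 < d x" by (simp add: d)
    then obtain k :: nat where k: "1 < real k * d x" using reals_Archimedean3 by blast
    have "a n x = 1" if "k \<le> n" for n
    proof -
      have "real k * d x \<le> real n * d x" using that d(2) by (intro mult_right_mono) auto
      then show ?thesis using k by (simp add: a_def)
    qed
    then show ?thesis using True
      by (intro tendsto_eventually) (auto simp: eventually_sequentially)
  next
    case False
    then have "d x = 0" using d(2)[of x] by (simp add: d(3))
    then show ?thesis using False by (simp add: a_def)
  qed
  have conv: "(\<lambda>n. \<integral>x. a n x \<partial>P) \<longlonglongrightarrow> measure P U"
    if P: "prob_space P" "sets P = sets borel" for P
  proof -
    interpret P: prob_space P by fact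
    have "(\<lambda>n. \<integral>x. a n x \<partial>P) \<longlonglongrightarrow> (\<integral>x. indicator U x \<partial>P)"
    proof (rule integral_dominated_convergence[where w = "\<lambda>_. 1"])
      show "a n \<in> borel_measurable P" for n
        using borel_measurable_continuous_onI[OF a] P(2) by (simp cong: measurable_cong_sets)
      show "(indicator U :: 'x \<Rightarrow> real) \<in> borel_measurable P" using U by (intro borel_measurable_indicator) (simp add: P(2))
      show "AE x in P. norm (a n x) \<le> 1" for n using d(2) by (simp add: a_def)
    qed (use lim in auto)
    then show ?thesis using P U by (simp add: sets_eq_imp_space_eq[OF P(2)])
  qed
  have "measure M U = measure N U"
    using conv[OF M] conv[OF N] eq[OF a] LIMSEQ_unique by fastforce
  then show "emeasure M U = emeasure N U"
    by (simp add: M.emeasure_eq_measure N.emeasure_eq_measure)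
qed (auto intro: exI[of _ UNIV])

text \<open>Tychonoff's theorem, with functionals viewed as points of a product of intervals. The
  proper filter \<open>H\<close> finer than \<open>G\<close> plays the part of a convergent
  subnet.\<close>

lemma bounded_functionals_cluster:
  fixes \<phi> :: "'i \<Rightarrow> 'a \<Rightarrow> real"
  assumes "G \<noteq> bot" and bound: "\<And>a. a \<in> S \<Longrightarrow> eventually (\<lambda>i. \<bar>\<phi> i a\<bar> \<le> B a) G"
  obtains H \<psi> where "H \<le> G" "H \<noteq> bot" "\<forall>a\<in>S. ((\<lambda>i. \<phi> i a) \<longlongrightarrow> \<psi> a) H"
proof -
  \<comment> \<open>Clamping puts every \<open>\<Phi> i\<close> in one compact product of intervals and, for each \<open>a \<in> S\<close>, changes
    \<open>\<phi> i a\<close> only outside a set of the filter.\<close>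
  define \<Phi> where "\<Phi> i a = max (- \<bar>B a\<bar>) (min \<bar>B a\<bar> (\<phi> i a))" for i a
  let ?K = "PiE UNIV (\<lambda>a. {- \<bar>B a\<bar> .. \<bar>B a\<bar>})"
  have "compactin (product_topology (\<lambda>_. euclidean) UNIV) ?K"
    by (subst compactin_PiE) auto
  then have "compact ?K" by (simp add: euclidean_product_topology)
  moreover have "filtermap \<Phi> G \<noteq> bot" using assms(1) by (simp add: filtermap_bot_iff)
  moreover have "eventually (\<lambda>u. u \<in> ?K) (filtermap \<Phi> G)"
    unfolding eventually_filtermap by (rule always_eventually) (auto simp: \<Phi>_def)
  ultimately obtain \<psi> where \<psi>: "inf (nhds \<psi>) (filtermap \<Phi> G) \<noteq> bot"
    unfolding compact_filter by blast
  \<comment> \<open>Adding the preimages of the neighbourhoods of \<open>\<psi>\<close> to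
    \<open>G\<close> turns the cluster point into a limit. The filter stays proper because each
    neighbourhood meets each set of the image filter.\<close>
  define H where "H = inf (filtercomap \<Phi> (nhds \<psi>)) G"
  show thesis
  proof
    show "H \<le> G" by (simp add: H_def)
    show "H \<noteq> bot"
    proof
      assume "H = bot"
      then obtain P Q where "eventually P (nhds \<psi>)" "eventually Q G" "\<And>i. P (\<Phi> i) \<Longrightarrow> Q i \<Longrightarrow> False"
        unfolding H_def trivial_limit_def eventually_inf eventually_filtercomap by blast
      then have "eventually P (nhds \<psi>)" "eventually (\<lambda>u. \<not> P u) (filtermap \<Phi> G)"
        unfolding eventually_filtermap by (auto elim!: eventually_mono)
      then have "inf (nhds \<psi>) (filtermap \<Phi> G) = bot"
        unfolding trivial_limit_def eventually_inf by blast
      with \<psi> show False by simp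
    qed
    show "\<forall>a\<in>S. ((\<lambda>i. \<phi> i a) \<longlongrightarrow> \<psi> a) H"
    proof
      fix a assume a: "a \<in> S"
      have "filterlim \<Phi> (nhds \<psi>) H"
        unfolding H_def by (meson filterlim_filtercomap filterlim_mono inf_le1 order_refl)
      then have "((\<lambda>i. \<Phi> i a) \<longlongrightarrow> \<psi> a) H"
        by (rule continuous_on_tendsto_compose[OF continuous_on_product_coordinates[of a]]) simp_all
      moreover have "eventually (\<lambda>i. \<Phi> i a = \<phi> i a) H"
        using filter_leD[OF \<open>H \<le> G\<close> bound[OF a]]
        by eventually_elim (unfold \<Phi>_def, linarith)
      ultimately show "((\<lambda>i. \<phi> i a) \<longlongrightarrow> \<psi> a) H" by (rule Lim_transform_eventually)
    qed
  qed
qed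

section \<open>Averages over sets of finite measure\<close>

definition mean :: "'a measure \<Rightarrow> 'a set \<Rightarrow> ('a \<Rightarrow> real) \<Rightarrow> real" where
  "mean M K u = (LINT y:K|M. u y) / measure M K"

lemma set_integrable_const_bounded:
  fixes u :: "'a \<Rightarrow> 'b::{banach, second_countable_topology}"
  assumes "K \<in> sets M" "emeasure M K < \<infinity>" "u \<in> borel_measurable M" "\<And>y. y \<in> K \<Longrightarrow> norm (u y) \<le> c"
  shows "set_integrable M K u"
  unfolding set_integrable_def using assms by (intro integrableI_bounded_set_indicator[of _ _ _ c]) auto

lemma norm_set_integral_le:
  fixes u :: "'a \<Rightarrow> 'b::{banach, second_countable_topology}"
  assumes "K \<in> sets M" "emeasure M K < \<infinity>" "set_integrable M K u" "\<And>y. y \<in> K \<Longrightarrow> norm (u y) \<le> c"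
  shows "norm (LINT y:K|M. u y) \<le> c * measure M K"
proof -
  have int: "integrable M (\<lambda>y. c * indicator K y)"
    using assms by simp
  have "norm (LINT y:K|M. u y) \<le> (\<integral>y. norm (indicator K y *\<^sub>R u y) \<partial>M)"
    unfolding set_lebesgue_integral_def by (rule integral_norm_bound)
  also have "\<dots> \<le> (\<integral>y. c * indicator K y \<partial>M)"
    using assms(4)
    by (intro integral_mono integrable_norm assms(3)[unfolded set_integrable_def] int)
      (auto simp: indicator_def)
  finally have "norm (LINT y:K|M. u y) \<le> (\<integral>y. c * indicator K y \<partial>M)" .
  then show ?thesis using assms by simp
qed

lemma set_integral_le_bound:
  fixes u :: "'a \<Rightarrow> real"
  assumes "K \<in> sets M" "emeasure M K < \<infinity>" "set_integrable M K u" "\<And>y. y \<in> K \<Longrightarrow> c \<le> u y"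
  shows "c * measure M K \<le> (LINT y:K|M. u y)"
proof -
  have "(LINT y:K|M. c) \<le> (LINT y:K|M. u y)"
    using assms by (intro set_integral_mono assms set_integrable_const_bounded[where c = "\<bar>c\<bar>"]) auto
  moreover have "(LINT y:K|M. c) = c * measure M K"
    using assms by (simp add: set_lebesgue_integral_def)
  ultimately show ?thesis by simp
qed

lemma mean_add:
  assumes "set_integrable M K u" "set_integrable M K v"
  shows "mean M K (\<lambda>y. u y + v y) = mean M K u + mean M K v"
  using assms by (simp add: mean_def set_integral_add add_divide_distrib)

lemma mean_diff:
  assumes "set_integrable M K u" "set_integrable M K v"
  shows "mean M K (\<lambda>y. u y - v y) = mean M K u - mean M K v"
  using assms by (simp add: mean_def set_integral_diff diff_divide_distrib)

lemma mean_scale: "mean M K (\<lambda>y. c * u y) = c * mean M K u"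
  by (simp add: mean_def)

lemma mean_const:
  assumes "K \<in> sets M" "0 < measure M K"
  shows "mean M K (\<lambda>_. c) = c"
  using assms by (simp add: mean_def set_lebesgue_integral_def)

text \<open>\<open>measure\<close> sends infinite mass to 0, so a positive value rules infinity
  out.\<close>

lemma measure_pos_emeasure_finite: "0 < measure M K \<Longrightarrow> emeasure M K < \<infinity>"
  by (metis infinity_ennreal_def less_irrefl measure_def enn2real_top top.not_eq_extremum)

lemma mean_abs_le:
  assumes "K \<in> sets M" "0 < measure M K" "set_integrable M K u" "\<And>y. y \<in> K \<Longrightarrow> \<bar>u y\<bar> \<le> c"
  shows "\<bar>mean M K u\<bar> \<le> c"
proof -
  have "emeasure M K < \<infinity>" using assms(2) by (rule measure_pos_emeasure_finite)
  then have "\<bar>LINT y:K|M. u y\<bar> \<le> c * measure M K"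
    using norm_set_integral_le[of K M u c] assms by simp
  then show ?thesis using assms(2) by (simp add: mean_def abs_divide divide_le_eq)
qed

lemma mean_ge:
  assumes "K \<in> sets M" "0 < measure M K" "set_integrable M K u" "\<And>y. y \<in> K \<Longrightarrow> c \<le> u y"
  shows "c \<le> mean M K u"
proof -
  have "emeasure M K < \<infinity>" using assms(2) by (rule measure_pos_emeasure_finite)
  then show ?thesis
    using set_integral_le_bound[of K M u c] assms by (simp add: mean_def le_divide_eq)
qed

text \<open>Complex averages are studied through real-valued linear maps \<open>L\<close>. By
  \<open>Avg_eq_alpha\<close> this covers the averages over the group as well as those over the
  space.\<close>

lemma bounded_linear_alpha:
  assumes "bounded_linear L" "set_integrable M K u"
  shows "L (alpha M K u) = mean M K (\<lambda>y. L (u y))"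
proof -
  interpret L: bounded_linear L by fact
  have "(\<integral>y. L (indicator K y *\<^sub>R u y) \<partial>M) = L (\<integral>y. indicator K y *\<^sub>R u y \<partial>M)"
    using assms(2) by (intro integral_bounded_linear assms(1)) (simp add: set_integrable_def)
  then show ?thesis
    by (simp add: alpha_def mean_def set_lebesgue_integral_def L.scaleR)
qed

lemma Avg_eq_alpha: "Avg m T K f x = alpha m K (\<lambda>g. f (T g x))"
  by (simp add: Avg_def alpha_def)

section \<open>Orbit averages\<close>

locale compact_action =
  fixes m :: "'g::{topological_group_add, t2_space} measure"
    and T :: "'g \<Rightarrow> 'x::topological_space \<Rightarrow> 'x"
  assumes haar: "left_haar_measure m"
    and compact_space: "compact (UNIV :: 'x set)"
    and action: "continuous_action T"
begin

lemma sets_m [simp, measurable_cong]: "sets m = sets borel"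
  using haar by (simp add: left_haar_measure_def radon_measure_def)

lemma space_m [simp]: "space m = UNIV"
  using sets_eq_imp_space_eq[OF sets_m] by simp

lemma compact_finite: "compact K \<Longrightarrow> emeasure m K < \<infinity>"
  using haar by (simp add: left_haar_measure_def radon_measure_def)

lemma compact_borel: "compact K \<Longrightarrow> K \<in> sets borel" for K :: "'g set"
  by (simp add: borel_closed compact_imp_closed)

text \<open>Left invariance in the push-forward form that a change of variables requires; the
  preimage under translation by \<open>g\<close> is the translate by \<open>- g\<close>.\<close>

lemma distr_translate: "distr m m ((+) g) = m"
proof (rule measure_eqI)
  fix A assume "A \<in> sets (distr m m ((+) g))"
  then have A: "A \<in> sets borel" by simp
  have "(+) g \<in> borel_measurable borel"
    by (intro borel_measurable_continuous_onI continuous_intros)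
  then have "(+) g \<in> measurable m m" by (simp cong: measurable_cong_sets)
  then have "emeasure (distr m m ((+) g)) A = emeasure m ((+) g -` A)"
    using A by (simp add: emeasure_distr)
  also have "(+) g -` A = (+) (- g) ` A"
    by (auto simp: image_iff) (metis minus_add_cancel)
  also have "emeasure m \<dots> = emeasure m A"
    using haar A by (simp add: left_haar_measure_def)
  finally show "emeasure (distr m m ((+) g)) A = emeasure m A" .
qed simp

lemma T_add: "T (g + h) x = T g (T h x)"
  using action by (simp add: continuous_action_def)

lemma continuous_on_orbit [continuous_intros]:
  fixes h :: "'x \<Rightarrow> 'b::topological_space"
  assumes "continuous_on UNIV h"
  shows "continuous_on A (\<lambda>p. h (T (fst p) (snd p)))"
    and "continuous_on B (\<lambda>g. h (T g x))"
    and "continuous_on C (\<lambda>x. h (T g x))"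
proof -
  have T: "continuous_on UNIV (\<lambda>p. T (fst p) (snd p))"
    using action by (simp add: continuous_action_def case_prod_beta')
  have hT: "continuous_on UNIV (\<lambda>p. h (T (fst p) (snd p)))"
    by (rule continuous_on_compose2[OF assms T]) auto
  show "continuous_on A (\<lambda>p. h (T (fst p) (snd p)))"
    by (rule continuous_on_subset[OF hT]) auto
  have "continuous_on UNIV (\<lambda>g. (g, x))" "continuous_on UNIV (\<lambda>x. (g, x))"
    by (intro continuous_intros)+
  from this[THEN continuous_on_compose2[OF hT]]
  show "continuous_on B (\<lambda>g. h (T g x))" "continuous_on C (\<lambda>x. h (T g x))"
    by (auto intro: continuous_on_subset)
qed

lemma bounded_on_space:
  fixes h :: "'x \<Rightarrow> 'b::real_normed_vector"
  assumes "continuous_on UNIV h"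
  obtains c where "0 < c" "\<And>x. norm (h x) \<le> c"
  using compact_imp_bounded[OF compact_continuous_image[OF assms compact_space]]
  by (auto simp: bounded_pos)

context
  fixes F B :: "'g set"
  assumes F: "compact F" and B: "B \<in> sets borel" "B \<subseteq> F"
begin

lemma B_finite: "emeasure m B < \<infinity>"
  using emeasure_mono[OF B(2), of m] compact_finite[OF F] compact_borel[OF F] by (auto simp: le_less_trans)

lemma set_integrable_orbit:
  fixes h :: "'x \<Rightarrow> 'b::{banach, second_countable_topology}"
  assumes "continuous_on UNIV h"
  shows "set_integrable m B (\<lambda>g. h (T g x))"
proof -
  obtain c where "\<And>x. norm (h x) \<le> c" using bounded_on_space[OF assms] by metis
  moreover have "(\<lambda>g. h (T g x)) \<in> borel_measurable m"
    using borel_measurable_continuous_onI[OF continuous_on_orbit(2)[OF assms]]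
    by (simp cong: measurable_cong_sets)
  ultimately show ?thesis
    using B B_finite by (intro set_integrable_const_bounded) auto
qed

text \<open>Compactness of \<open>F\<close> makes the dependence on \<open>x\<close> uniform over
  the group elements. \<open>B\<close> is any Borel part of \<open>F\<close>, since
  \<open>integral_orbit_integral\<close> cuts \<open>F\<close> into pieces that need not be
  compact.\<close>

lemma continuous_on_orbit_integral:
  fixes h :: "'x \<Rightarrow> 'b::{banach, second_countable_topology}"
  assumes h: "continuous_on UNIV h"
  shows "continuous_on UNIV (\<lambda>x. LINT g:B|m. h (T g x))"
  unfolding continuous_on_def
proof (intro ballI tendstoI)
  fix x :: 'x and e :: real assume "0 < e"
  \<comment> \<open>The added 1 keeps the divisor positive when \<open>B\<close> is null.\<close>
  define d where "d = e / (1 + measure m B)"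
  have d: "0 < d" "d * measure m B < e"
    using \<open>0 < e\<close> by (auto simp: d_def field_simps add_nonneg_pos add_pos_nonneg)
  \<comment> \<open>The factors are swapped because \<open>continuous_on_prod_compactE\<close> is
    uniform in the second coordinate.\<close>
  have "continuous_on (UNIV \<times> F) (\<lambda>p. h (T (snd p) (fst p)))"
    using continuous_on_compose2[OF continuous_on_orbit(1)[OF h, of UNIV] continuous_on_swap, of "UNIV \<times> F"]
    by (simp add: case_prod_beta')
  from continuous_on_prod_compactE[OF this F UNIV_I d(1)]
  obtain X0 where X0: "x \<in> X0" "open X0" and "\<forall>y\<in>X0 \<inter> UNIV. \<forall>g\<in>F.
      dist (h (T (snd (y, g)) (fst (y, g)))) (h (T (snd (x, g)) (fst (x, g)))) \<le> d" .
  then have close: "norm (h (T g y) - h (T g x)) \<le> d" if "y \<in> X0" "g \<in> F" for y g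
    using that by (simp add: dist_norm)
  have "dist (LINT g:B|m. h (T g y)) (LINT g:B|m. h (T g x)) < e" if "y \<in> X0" for y
  proof -
    have "dist (LINT g:B|m. h (T g y)) (LINT g:B|m. h (T g x)) = norm (LINT g:B|m. h (T g y) - h (T g x))"
      unfolding dist_norm
      by (subst set_integral_diff(2)) (auto intro: set_integrable_orbit[OF h])
    also have "\<dots> \<le> d * measure m B"
      using B B_finite close[OF that]
      by (intro norm_set_integral_le set_integral_diff(1) set_integrable_orbit[OF h]) auto
    finally show ?thesis using d by simp
  qed
  then show "eventually (\<lambda>y. dist (LINT g:B|m. h (T g y)) (LINT g:B|m. h (T g x)) < e) (at x)"
    unfolding eventually_at_topological using X0 by blast
qed

end

definition orbit_mean :: "'g set \<Rightarrow> ('x \<Rightarrow> real) \<Rightarrow> 'x \<Rightarrow> real" where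
  "orbit_mean F h x = mean m F (\<lambda>g. h (T g x))"

lemma continuous_on_orbit_mean:
  assumes "compact F" "continuous_on UNIV h"
  shows "continuous_on UNIV (orbit_mean F h)"
  using continuous_on_orbit_integral[OF assms(1) compact_borel[OF assms(1)] subset_refl assms(2)]
  unfolding orbit_mean_def mean_def divide_inverse by (intro continuous_intros)

lemma set_integral_translate:
  fixes u :: "'g \<Rightarrow> real"
  assumes "continuous_on UNIV u" "compact F"
  shows "(LINT k:F|m. u (g + k)) = (LINT k:(+) g ` F|m. u k)"
proof -
  have tr: "(+) g \<in> measurable m m"
    by (simp cong: measurable_cong_sets) (intro borel_measurable_continuous_onI continuous_intros)
  have gF: "(+) g ` F \<in> sets borel"
    using assms(2) by (intro compact_borel compact_continuous_image continuous_intros)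
  have u: "(\<lambda>k. indicator ((+) g ` F) k *\<^sub>R u k) \<in> borel_measurable m"
    using gF borel_measurable_continuous_onI[OF assms(1)] by measurable
  have "(LINT k:(+) g ` F|m. u k) = (\<integral>k. indicator ((+) g ` F) k *\<^sub>R u k \<partial>distr m m ((+) g))"
    by (simp add: distr_translate set_lebesgue_integral_def)
  also have "\<dots> = (\<integral>k. indicator ((+) g ` F) (g + k) *\<^sub>R u (g + k) \<partial>m)"
    by (rule integral_distr[OF tr u])
  also have "\<dots> = (LINT k:F|m. u (g + k))"
    by (simp add: set_lebesgue_integral_def indicator_def image_iff)
  finally show ?thesis ..
qed

text \<open>The two integrands agree off the symmetric difference and differ there by
  \<open>\<bar>u k\<bar> \<le> c\<close>.\<close>

lemma set_integral_sym_diff_le: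
  fixes u :: "'g \<Rightarrow> real"
  assumes u: "continuous_on UNIV u" "\<And>k. \<bar>u k\<bar> \<le> c" and A: "compact A" "compact B"
  shows "\<bar>(LINT k:A|m. u k) - (LINT k:B|m. u k)\<bar> \<le> c * measure m (sym_diff A B)"
proof -
  have AB: "A \<in> sets m" "B \<in> sets m" using A compact_borel by auto
  have fin: "emeasure m A < \<infinity>" "emeasure m B < \<infinity>" using A compact_finite by auto
  have um: "u \<in> borel_measurable m"
    using borel_measurable_continuous_onI[OF u(1)] by (simp cong: measurable_cong_sets)
  have si: "set_integrable m A u" "set_integrable m B u"
    using AB fin um u(2) by (auto intro!: set_integrable_const_bounded)
  have "emeasure m (sym_diff A B) \<le> emeasure m (A \<union> B)" using AB by (intro emeasure_mono) auto
  also have "\<dots> < \<infinity>" using compact_finite[OF compact_Un[OF A]] .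
  finally have sd: "emeasure m (sym_diff A B) < \<infinity>" .
  have "\<bar>(LINT k:A|m. u k) - (LINT k:B|m. u k)\<bar>
      = norm (\<integral>k. indicator A k *\<^sub>R u k - indicator B k *\<^sub>R u k \<partial>m)"
    using si by (simp add: set_lebesgue_integral_def set_integrable_def)
  also have "\<dots> \<le> (\<integral>k. norm (indicator A k *\<^sub>R u k - indicator B k *\<^sub>R u k) \<partial>m)"
    by (rule integral_norm_bound)
  also have "\<dots> \<le> (\<integral>k. c * indicator (sym_diff A B) k \<partial>m)"
  proof (rule integral_mono)
    show "integrable m (\<lambda>k. norm (indicator A k *\<^sub>R u k - indicator B k *\<^sub>R u k))"
      using si unfolding set_integrable_def by (intro integrable_norm Bochner_Integration.integrable_diff)
    show "integrable m (\<lambda>k. c * indicator (sym_diff A B) k)"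
      using sd AB by (intro integrable_mult_right integrable_real_indicator) auto
    show "norm (indicator A k *\<^sub>R u k - indicator B k *\<^sub>R u k) \<le> c * indicator (sym_diff A B) k" for k
      using u(2)[of k] by (auto simp: indicator_def)
  qed
  finally show ?thesis using AB by simp
qed

text \<open>Since \<open>T g (T k x) = T (g + k) x\<close>, composing \<open>h\<close> with
  \<open>T g\<close> moves the integral from \<open>F\<close> to its left translate, and the
  discrepancy is governed by the Folner ratio.\<close>

lemma orbit_mean_translate:
  assumes h: "continuous_on UNIV h" "\<And>x. \<bar>h x\<bar> \<le> c" and F: "compact F" "0 < measure m F"
  shows "\<bar>orbit_mean F (\<lambda>x. h (T g x)) x - orbit_mean F h x\<bar>
    \<le> c * (measure m (sym_diff ((+) g ` F) F) / measure m F)"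
proof -
  have u: "continuous_on UNIV (\<lambda>k. h (T k x))" by (rule continuous_on_orbit(2)[OF h(1)])
  have "(LINT k:F|m. h (T g (T k x))) = (LINT k:(+) g ` F|m. h (T k x))"
    using set_integral_translate[OF u F(1)] by (simp add: T_add)
  moreover have "compact ((+) g ` F)"
    by (intro compact_continuous_image continuous_intros F)
  ultimately have "\<bar>(LINT k:F|m. h (T g (T k x))) - (LINT k:F|m. h (T k x))\<bar>
      \<le> c * measure m (sym_diff ((+) g ` F) F)"
    using set_integral_sym_diff_le[OF u h(2) _ F(1)] by simp
  then show ?thesis
    using F(2) by (simp add: orbit_mean_def mean_def flip: diff_divide_distrib) (simp add: divide_right_mono)
qed

end

section \<open>Nets as proper filters\<close>

lemma net_filter_neq_bot:
  assumes "directed_set I le"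
  shows "net_filter I le \<noteq> bot"
  unfolding trivial_limit_def eventually_net_filter[OF assms]
  using assms by (auto simp: directed_set_def reflp_on_def)

lemma eventually_in_index_set:
  assumes "directed_set I le"
  shows "eventually (\<lambda>i. i \<in> I) (net_filter I le)"
  unfolding eventually_net_filter[OF assms] using assms by (auto simp: directed_set_def)

context compact_action
begin

section \<open>Invariant measures and orbit averages\<close>

lemma invariant_measuresD:
  assumes "\<nu> \<in> invariant_measures T"
  shows "prob_space \<nu>" "sets \<nu> = sets borel" "space \<nu> = UNIV" "distr \<nu> borel (T g) = \<nu>"
  using assms sets_eq_imp_space_eq[of \<nu> borel] by (auto simp: invariant_measures_def)

lemma integrable_invariant_measure:
  fixes h :: "'x \<Rightarrow> 'b::{banach, second_countable_topology}"
  assumes "\<nu> \<in> invariant_measures T" "continuous_on UNIV h"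
  shows "integrable \<nu> h"
  using invariant_measuresD(1,2)[OF assms(1)] compact_space assms(2)
  by (intro integrable_continuous_compact) (auto simp: prob_space.finite_measure)

lemma T_borel: "T g \<in> borel_measurable borel"
proof (rule borel_measurable_continuous_onI)
  have "continuous_on UNIV (id :: 'x \<Rightarrow> 'x)" by (rule continuous_on_id')
  from continuous_on_orbit(3)[OF this, of UNIV g] show "continuous_on UNIV (T g)" by simp
qed

lemma integral_translate:
  fixes h :: "'x \<Rightarrow> real"
  assumes \<nu>: "\<nu> \<in> invariant_measures T" and h: "continuous_on UNIV h"
  shows "(\<integral>x. h (T g x) \<partial>\<nu>) = (\<integral>x. h x \<partial>\<nu>)"
proof -
  have "T g \<in> measurable \<nu> borel"
    using T_borel invariant_measuresD(2)[OF \<nu>] by (simp cong: measurable_cong_sets)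
  then have "(\<integral>x. h x \<partial>distr \<nu> borel (T g)) = (\<integral>x. h (T g x) \<partial>\<nu>)"
    using borel_measurable_continuous_onI[OF h] by (rule integral_distr)
  then show ?thesis by (simp add: invariant_measuresD(4)[OF \<nu>])
qed

text \<open>The Borel sets of \<open>G \<times> X\<close> may be strictly larger than the product of the Borel algebras, as \<open>G\<close> need
  not be second countable. Instead of Fubini, \<open>F\<close> is cut into finitely many pieces on which
  \<open>g \<mapsto> h \<circ> T\<^sub>g\<close> is uniformly almost constant.\<close>

lemma integral_orbit_integral:
  fixes h :: "'x \<Rightarrow> real"
  assumes \<nu>: "\<nu> \<in> invariant_measures T" and h: "continuous_on UNIV h" and F: "compact F"
  shows "(\<integral>x. (LINT g:F|m. h (T g x)) \<partial>\<nu>) = measure m F * (\<integral>x. h x \<partial>\<nu>)"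
proof -
  interpret prob_space \<nu> by (rule invariant_measuresD(1)[OF \<nu>])
  define J where "J = (\<integral>x. h x \<partial>\<nu>)"
  have int: "integrable \<nu> (\<lambda>x. LINT g:B|m. h (T g x))" if "B \<in> sets borel" "B \<subseteq> F" for B
    by (intro integrable_invariant_measure[OF \<nu>] continuous_on_orbit_integral[OF F that] h)
  have approx: "\<bar>(\<integral>x. (LINT g:F|m. h (T g x)) \<partial>\<nu>) - measure m F * J\<bar> \<le> e * measure m F"
    if e: "0 < e" for e
  proof -
    \<comment> \<open>Compactness of the space gives one neighbourhood of \<open>j\<close> that
      works for all points \<open>x\<close> at once.\<close>
    have "\<exists>N. j \<in> N \<and> open N \<and> (\<forall>g\<in>N. \<forall>x. \<bar>h (T g x) - h (T j x)\<bar> \<le> e)" for j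
    proof -
      from continuous_on_prod_compactE[OF continuous_on_orbit(1)[OF h, of "UNIV \<times> UNIV"] compact_space UNIV_I e, of j]
      obtain N where "j \<in> N" "open N" and "\<forall>g\<in>N \<inter> UNIV. \<forall>x\<in>UNIV.
          dist (h (T (fst (g, x)) (snd (g, x)))) (h (T (fst (j, x)) (snd (j, x)))) \<le> e" .
      then show ?thesis by (intro exI[of _ N]) (simp add: dist_real_def)
    qed
    then obtain N where N: "\<And>j. j \<in> N j" "\<And>j. open (N j)"
      "\<And>j g x. g \<in> N j \<Longrightarrow> \<bar>h (T g x) - h (T j x)\<bar> \<le> e" by metis
    \<comment> \<open>On a piece inside \<open>N j\<close>, replacing \<open>T g\<close> by
      \<open>T j\<close> costs at most \<open>e\<close>, and invariance of \<open>\<nu>\<close>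
      turns the integral of \<open>h (T j x)\<close> into \<open>J\<close>.\<close>
    have small: "\<bar>(\<integral>x. (LINT g:B|m. h (T g x)) \<partial>\<nu>) - measure m B * J\<bar> \<le> e * measure m B"
      if B: "B \<in> sets borel" "B \<subseteq> F" "B \<subseteq> N j" for B j
    proof -
      have Bfin: "emeasure m B < \<infinity>" by (rule B_finite[OF F B(1,2)])
      have Bsets: "B \<in> sets m" using B(1) by simp
      have const: "(LINT g:B|m. c) = measure m B * c" for c :: real
        using Bsets Bfin by (simp add: set_lebesgue_integral_def)
      have si: "set_integrable m B (\<lambda>g. h (T g x))" "set_integrable m B (\<lambda>g. c)" for x and c :: real
        by (rule set_integrable_orbit[OF F B(1,2) h])
          (auto intro!: set_integrable_const_bounded[OF Bsets Bfin])
      have pw: "\<bar>(LINT g:B|m. h (T g x)) - measure m B * h (T j x)\<bar> \<le> e * measure m B" for x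
      proof -
        have "(LINT g:B|m. h (T g x)) - measure m B * h (T j x) = (LINT g:B|m. h (T g x) - h (T j x))"
          using si by (simp add: set_integral_diff const)
        then show ?thesis
          using norm_set_integral_le[OF Bsets Bfin set_integral_diff(1)[OF si(1)[of x] si(2)[of "h (T j x)"]], of e] N(3) B(3)
          by auto
      qed
      have hT: "integrable \<nu> (\<lambda>x. measure m B * h (T j x))"
        by (intro integrable_mult_right integrable_invariant_measure[OF \<nu>] continuous_on_orbit(3) h)
      have "\<bar>(\<integral>x. (LINT g:B|m. h (T g x)) \<partial>\<nu>) - measure m B * J\<bar>
          = \<bar>\<integral>x. (LINT g:B|m. h (T g x)) - measure m B * h (T j x) \<partial>\<nu>\<bar>"
        using int[OF B(1,2)] hT by (simp add: integral_translate[OF \<nu> h] J_def)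
      also have "\<dots> \<le> (\<integral>x. e * measure m B \<partial>\<nu>)"
        using int[OF B(1,2)] hT pw
        by (intro order_trans[OF integral_abs_bound] integral_mono) auto
      finally show ?thesis using prob_space by simp
    qed
    \<comment> \<open>The error on each piece is proportional to its measure, so disjoint pieces add
      up to \<open>e * measure m B\<close> however many there are.\<close>
    have finite_cover: "\<bar>(\<integral>x. (LINT g:B|m. h (T g x)) \<partial>\<nu>) - measure m B * J\<bar> \<le> e * measure m B"
      if "finite D" "B \<in> sets borel" "B \<subseteq> F" "B \<subseteq> (\<Union>j\<in>D. N j)" for D B
      using that
    proof (induction D arbitrary: B rule: finite_induct)
      case empty
      then show ?case by (simp add: set_lebesgue_integral_def)
    next
      case (insert j D)
      define B1 B2 where "B1 = B \<inter> N j" and "B2 = B - N j"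
      have B12: "B1 \<in> sets borel" "B2 \<in> sets borel" "B1 \<subseteq> F" "B2 \<subseteq> F" "B1 \<inter> B2 = {}" "B = B1 \<union> B2"
        using insert.prems N(2)[of j] by (auto simp: B1_def B2_def)
      have "(LINT g:B|m. h (T g x)) = (LINT g:B1|m. h (T g x)) + (LINT g:B2|m. h (T g x))" for x
        unfolding B12(6) using B12
        by (intro set_integral_Un set_integrable_orbit[OF F _ _ h]) auto
      then have I: "(\<integral>x. (LINT g:B|m. h (T g x)) \<partial>\<nu>)
          = (\<integral>x. (LINT g:B1|m. h (T g x)) \<partial>\<nu>) + (\<integral>x. (LINT g:B2|m. h (T g x)) \<partial>\<nu>)"
        using int B12 by simp
      have "emeasure m B1 \<noteq> \<infinity>" "emeasure m B2 \<noteq> \<infinity>"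
        using B_finite[OF F B12(1,3)] B_finite[OF F B12(2,4)] by simp_all
      then have M: "measure m B = measure m B1 + measure m B2"
        unfolding B12(6) using B12(1,2,5) by (intro measure_Union) simp_all
      have "\<bar>(\<integral>x. (LINT g:B1|m. h (T g x)) \<partial>\<nu>) - measure m B1 * J\<bar> \<le> e * measure m B1"
        by (rule small[OF B12(1,3), of j]) (simp add: B1_def)
      moreover have "\<bar>(\<integral>x. (LINT g:B2|m. h (T g x)) \<partial>\<nu>) - measure m B2 * J\<bar> \<le> e * measure m B2"
        by (rule insert.IH[OF B12(2,4)]) (use insert.prems in \<open>auto simp: B2_def\<close>)
      ultimately show ?case unfolding I M by (simp add: algebra_simps)
    qed
    obtain D where "D \<subseteq> UNIV" "finite D" "F \<subseteq> (\<Union>j\<in>D. N j)"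
      using compactE_image[OF F, of UNIV N] N(1,2) by blast
    then show ?thesis using compact_borel[OF F] by (intro finite_cover[of D]) auto
  qed
  have "\<bar>(\<integral>x. (LINT g:F|m. h (T g x)) \<partial>\<nu>) - measure m F * J\<bar> \<le> 0"
  proof (rule field_le_epsilon)
    fix e :: real assume "0 < e"
    then have "0 < e / (1 + measure m F)" by (intro divide_pos_pos add_pos_nonneg) auto
    note approx[OF this]
    also have "e / (1 + measure m F) * measure m F \<le> e"
      using \<open>0 < e\<close> by (simp add: divide_le_eq add_pos_nonneg algebra_simps)
    finally show "\<bar>(\<integral>x. (LINT g:F|m. h (T g x)) \<partial>\<nu>) - measure m F * J\<bar> \<le> 0 + e" by simp
  qed
  then show ?thesis by (simp add: J_def)
qed

lemma integral_orbit_mean: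
  assumes "\<nu> \<in> invariant_measures T" "continuous_on UNIV h" "compact F" "0 < measure m F"
  shows "(\<integral>x. orbit_mean F h x \<partial>\<nu>) = (\<integral>x. h x \<partial>\<nu>)"
  using integral_orbit_integral[OF assms(1-3)] assms(4) by (simp add: orbit_mean_def mean_def)

text \<open>Moving \<open>L\<close> through both averages reduces the complex spatial-temporal
  average to a real one, where order arguments and the positive functional are available.\<close>

lemma bounded_linear_alpha_Avg:
  assumes L: "bounded_linear L" and f: "continuous_on UNIV f"
    and \<mu>: "\<mu> \<in> invariant_measures T" and C: "C \<in> sets borel" and F: "compact F"
  shows "L (alpha \<mu> C (Avg m T F f)) = mean \<mu> C (orbit_mean F (\<lambda>x. L (f x)))"
proof -
  have FF: "F \<in> sets borel" "F \<subseteq> F" using compact_borel[OF F] by auto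
  have "continuous_on UNIV (Avg m T F f)"
    using continuous_on_orbit_integral[OF F FF f] unfolding Avg_def by (intro continuous_intros)
  then have "integrable \<mu> (Avg m T F f)" by (rule integrable_invariant_measure[OF \<mu>])
  then have "set_integrable \<mu> C (Avg m T F f)"
    unfolding set_integrable_def using C invariant_measuresD(2)[OF \<mu>]
    by (intro integrable_mult_indicator) auto
  then have "L (alpha \<mu> C (Avg m T F f)) = mean \<mu> C (\<lambda>x. L (Avg m T F f x))"
    by (rule bounded_linear_alpha[OF L])
  also have "(\<lambda>x. L (Avg m T F f x)) = orbit_mean F (\<lambda>x. L (f x))"
    unfolding Avg_eq_alpha orbit_mean_def
    by (intro ext bounded_linear_alpha[OF L] set_integrable_orbit[OF F FF f])
  finally show ?thesis .
qed

lemma set_integrable_orbit_mean: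
  assumes "\<mu> \<in> invariant_measures T" "C \<in> sets borel" "compact F" "continuous_on UNIV h"
  shows "set_integrable \<mu> C (orbit_mean F h)"
  unfolding set_integrable_def
  using integrable_invariant_measure[OF assms(1) continuous_on_orbit_mean[OF assms(3,4)]]
    assms(2) invariant_measuresD(2)[OF assms(1)]
  by (intro integrable_mult_indicator) auto

section \<open>Herman functions\<close>

lemma averages_converge_open_imp_herman:
  assumes \<mu>: "\<mu> \<in> invariant_measures T" and full: "fully_supported \<mu>"
    and folner: "folner_net m I le F" and f: "continuous_on UNIV f"
    and conv: "averages_converge m T \<mu> I le F f {U. open U}"
  shows "herman T f"
proof (rule ccontr)
  assume "\<not> herman T f"
  then obtain \<nu> where \<nu>: "\<nu> \<in> invariant_measures T" "(\<integral>x. f x \<partial>\<nu>) \<noteq> (\<integral>x. f x \<partial>\<mu>)"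
    unfolding herman_def is_singleton_def using \<mu> by blast
  define z where "z = (\<integral>x. f x \<partial>\<nu>) - (\<integral>x. f x \<partial>\<mu>)"
  \<comment> \<open>Projection onto the direction of \<open>z\<close>: its value at \<open>z\<close>
    is the square of the modulus, so \<open>L\<close> strictly separates the two integrals.\<close>
  define L where "L w = Re (cnj z * w)" for w
  have L: "bounded_linear L"
    unfolding L_def by (intro bounded_linear_compose[OF bounded_linear_Re] bounded_linear_mult_right)
  interpret L: bounded_linear L by (rule L)
  define p where "p x = L (f x)" for x
  have p: "continuous_on UNIV p" unfolding p_def by (rule L.continuous_on[OF f])
  have "L (\<integral>x. f x \<partial>\<nu>) - L (\<integral>x. f x \<partial>\<mu>) = L z" by (simp add: z_def L.diff)
  also have "L z = (cmod z)\<^sup>2" by (simp add: L_def cmod_def power2_eq_square)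
  finally have less: "L (\<integral>x. f x \<partial>\<mu>) < L (\<integral>x. f x \<partial>\<nu>)"
    using \<nu>(2) by (metis diff_gt_0_iff_gt z_def right_minus_eq zero_less_norm_iff zero_less_power)
  have p_int: "(\<integral>x. p x \<partial>\<nu>) = L (\<integral>x. f x \<partial>\<nu>)"
    unfolding p_def by (intro integral_bounded_linear L integrable_invariant_measure \<nu> f)
  obtain c where c: "L (\<integral>x. f x \<partial>\<mu>) < c" "c < L (\<integral>x. f x \<partial>\<nu>)" using dense[OF less] by blast
  define U where "U i = {x. c < orbit_mean (F i) p x}" for i
  have dir: "directed_set I le" and F: "\<And>i. i \<in> I \<Longrightarrow> compact (F i) \<and> 0 < measure m (F i)"
    using folner by (auto simp: folner_net_def)
  have U: "open (U i)" "0 < measure \<mu> (U i)" if i: "i \<in> I" for i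
  proof -
    show "open (U i)"
      unfolding U_def using F[OF i] p by (intro open_Collect_less continuous_intros continuous_on_orbit_mean) auto
    moreover have "U i \<noteq> {}"
    proof
      assume "U i = {}"
      then have le: "orbit_mean (F i) p x \<le> c" for x by (auto simp: U_def not_less)
      interpret \<nu>: prob_space \<nu> by (rule invariant_measuresD(1)[OF \<nu>(1)])
      have "(\<integral>x. p x \<partial>\<nu>) = (\<integral>x. orbit_mean (F i) p x \<partial>\<nu>)"
        using integral_orbit_mean[OF \<nu>(1) p] F[OF i] by simp
      also have "\<dots> \<le> (\<integral>x. c \<partial>\<nu>)"
        using le F[OF i]
        by (intro integral_mono integrable_invariant_measure[OF \<nu>(1)] continuous_on_orbit_mean p) auto
      finally show False using c p_int \<nu>.prob_space by simp
    qed
    \<comment> \<open>Full support turns nonemptiness into positive mass, which makes the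
      \<open>U i\<close> admissible in \<open>conv\<close>.\<close>
    ultimately show "0 < measure \<mu> (U i)" using full by (simp add: fully_supported_def)
  qed
  have "((\<lambda>i. alpha \<mu> (U i) (Avg m T (F i) f)) \<longlongrightarrow> (\<integral>x. f x \<partial>\<mu>)) (net_filter I le)"
    using conv U by (simp add: averages_converge_def)
  then have "((\<lambda>i. L (alpha \<mu> (U i) (Avg m T (F i) f))) \<longlongrightarrow> L (\<integral>x. f x \<partial>\<mu>)) (net_filter I le)"
    by (rule L.tendsto)
  moreover have "eventually (\<lambda>i. c \<le> L (alpha \<mu> (U i) (Avg m T (F i) f))) (net_filter I le)"
    using eventually_in_index_set[OF dir]
  proof eventually_elim
    case (elim i)
    note Fi = F[OF elim] and Ui = U[OF elim]
    have "L (alpha \<mu> (U i) (Avg m T (F i) f)) = mean \<mu> (U i) (orbit_mean (F i) p)"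
      unfolding p_def using Fi Ui by (intro bounded_linear_alpha_Avg L f \<mu>) auto
    also have "c \<le> \<dots>"
      using Fi Ui p invariant_measuresD(2)[OF \<mu>]
      by (intro mean_ge set_integrable_orbit_mean \<mu>) (auto simp: U_def)
    finally show ?case .
  qed
  ultimately have "c \<le> L (\<integral>x. f x \<partial>\<mu>)"
    by (rule tendsto_lowerbound[OF _ _ net_filter_neq_bot[OF dir]])
  with c(1) show False by simp
qed

lemma herman_imp_averages_converge:
  assumes metr: "metrizable_space (euclidean :: 'x topology)"
    and \<mu>: "\<mu> \<in> invariant_measures T"
    and folner: "folner_net m I le F" and f: "continuous_on UNIV f"
    and herman: "herman T f"
  shows "averages_converge m T \<mu> I le F f (sets borel)"
  unfolding averages_converge_def
proof (intro allI impI, rule ccontr)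
  fix C assume C: "\<forall>i\<in>I. C i \<in> sets borel \<and> 0 < measure \<mu> (C i)"
  let ?\<Lambda> = "\<lambda>i. alpha \<mu> (C i) (Avg m T (F i) f)" and ?\<N> = "net_filter I le"
  assume "\<not> (?\<Lambda> \<longlongrightarrow> (\<integral>x. f x \<partial>\<mu>)) ?\<N>"
  then obtain e where e: "0 < e" "\<not> eventually (\<lambda>i. dist (?\<Lambda> i) (\<integral>x. f x \<partial>\<mu>) < e) ?\<N>"
    by (auto simp: tendsto_iff)
  have dir: "directed_set I le" and F: "\<And>i. i \<in> I \<Longrightarrow> compact (F i)" "\<And>i. i \<in> I \<Longrightarrow> 0 < measure m (F i)"
    and ratio: "\<And>g. ((\<lambda>i. measure m (sym_diff ((+) g ` F i) (F i)) / measure m (F i)) \<longlongrightarrow> 0) ?\<N>"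
    using folner by (auto simp: folner_net_def)
  define \<phi> where "\<phi> i a = mean \<mu> (C i) (orbit_mean (F i) a)" for i a
  have Fm: "F i \<in> sets m" "F i \<in> sets borel" if "i \<in> I" for i
    using compact_borel[OF F(1)[OF that]] by auto
  have C\<mu>: "C i \<in> sets \<mu>" "C i \<in> sets borel" "0 < measure \<mu> (C i)" if "i \<in> I" for i
    using C that invariant_measuresD(2)[OF \<mu>] by auto
  have orb: "set_integrable m (F i) (\<lambda>g. a (T g x))"
    if "i \<in> I" "continuous_on UNIV a" for i x and a :: "'x \<Rightarrow> real"
    using set_integrable_orbit[OF F(1)[OF that(1)] Fm(2)[OF that(1)] subset_refl that(2)] .
  have spc: "set_integrable \<mu> (C i) (orbit_mean (F i) a)" if "i \<in> I" "continuous_on UNIV a" for i a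
    using set_integrable_orbit_mean[OF \<mu>] C\<mu> F that by auto
  have \<phi>_add: "\<phi> i (\<lambda>x. a x + b x) = \<phi> i a + \<phi> i b"
    if i: "i \<in> I" and ab: "continuous_on UNIV a" "continuous_on UNIV b" for i a b
  proof -
    have "orbit_mean (F i) (\<lambda>x. a x + b x) = (\<lambda>x. orbit_mean (F i) a x + orbit_mean (F i) b x)"
      unfolding orbit_mean_def by (intro ext mean_add orb i ab)
    then show ?thesis unfolding \<phi>_def using spc[OF i] ab by (simp add: mean_add)
  qed
  have \<phi>_scale: "\<phi> i (\<lambda>x. c * a x) = c * \<phi> i a" for i c a
    unfolding \<phi>_def orbit_mean_def by (simp add: mean_scale)
  have \<phi>_one: "\<phi> i (\<lambda>_. 1) = 1" if "i \<in> I" for i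
    unfolding \<phi>_def orbit_mean_def using Fm C\<mu> F that by (simp add: mean_const)
  have \<phi>_nonneg: "0 \<le> \<phi> i a" if i: "i \<in> I" and a: "continuous_on UNIV a" "\<And>x. 0 \<le> a x" for i a
    unfolding \<phi>_def using C\<mu>[OF i] F[OF i] Fm[OF i] a
    by (intro mean_ge spc i a) (auto simp: orbit_mean_def intro!: mean_ge orb i)
  have \<phi>_bound: "\<bar>\<phi> i a\<bar> \<le> c" if i: "i \<in> I" and a: "continuous_on UNIV a" "\<And>x. \<bar>a x\<bar> \<le> c" for i a c
    unfolding \<phi>_def using C\<mu>[OF i] F[OF i] Fm[OF i] a
    by (intro mean_abs_le spc i a) (auto simp: orbit_mean_def intro!: mean_abs_le orb i)
  have \<phi>_translate: "\<bar>\<phi> i (\<lambda>x. a (T g x)) - \<phi> i a\<bar>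
      \<le> c * (measure m (sym_diff ((+) g ` F i) (F i)) / measure m (F i))"
    if i: "i \<in> I" and a: "continuous_on UNIV a" "\<And>x. \<bar>a x\<bar> \<le> c" for i a c g
  proof -
    have ag: "continuous_on UNIV (\<lambda>x. a (T g x))" by (rule continuous_on_orbit(3)[OF a(1)])
    have "\<phi> i (\<lambda>x. a (T g x)) - \<phi> i a
        = mean \<mu> (C i) (\<lambda>x. orbit_mean (F i) (\<lambda>x. a (T g x)) x - orbit_mean (F i) a x)"
      unfolding \<phi>_def using spc[OF i ag] spc[OF i a(1)] by (simp add: mean_diff)
    then show ?thesis
      using mean_abs_le[OF C\<mu>(1,3)[OF i] set_integral_diff(1)[OF spc[OF i ag] spc[OF i a(1)]]
          orbit_mean_translate[OF a F(1)[OF i] F(2)[OF i]]] by simp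
  qed
  \<comment> \<open>\<open>G\<close> restricts the net to its bad indices. It is proper because
    otherwise the averages would eventually be within \<open>e\<close> of the limit.\<close>
  define G where "G = inf ?\<N> (principal {i. \<not> dist (?\<Lambda> i) (\<integral>x. f x \<partial>\<mu>) < e})"
  have G: "G \<noteq> bot" "G \<le> ?\<N>" "eventually (\<lambda>i. \<not> dist (?\<Lambda> i) (\<integral>x. f x \<partial>\<mu>) < e) G"
    using e(2) by (auto simp: G_def trivial_limit_def eventually_inf_principal)
  let ?S = "{a :: 'x \<Rightarrow> real. continuous_on UNIV a}"
  have "\<forall>a\<in>?S. \<exists>c. \<forall>x. \<bar>a x\<bar> \<le> c"
    using bounded_on_space by (metis mem_Collect_eq real_norm_def)
  then obtain B where B: "\<And>a x. a \<in> ?S \<Longrightarrow> \<bar>a x\<bar> \<le> B a" by metis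
  have bound: "eventually (\<lambda>i. \<bar>\<phi> i a\<bar> \<le> B a) G" if "a \<in> ?S" for a
    using filter_leD[OF G(2) eventually_in_index_set[OF dir]]
    by eventually_elim (use \<phi>_bound B that in auto)
  obtain H \<psi> where H: "H \<le> G" "H \<noteq> bot" and "\<forall>a\<in>?S. ((\<lambda>i. \<phi> i a) \<longlongrightarrow> \<psi> a) H"
    by (rule bounded_functionals_cluster[where S = ?S, OF G(1) bound])
  then have lim: "((\<lambda>i. \<phi> i a) \<longlongrightarrow> \<psi> a) H" if "continuous_on UNIV a" for a
    using that by simp
  have inI: "eventually (\<lambda>i. i \<in> I) H"
    using filter_leD[OF H(1) filter_leD[OF G(2) eventually_in_index_set[OF dir]]] .
  \<comment> \<open>Each law of \<open>\<phi> i\<close> for \<open>i \<in> I\<close> holds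
    eventually along \<open>H\<close> and passes to the limit; the equalities use that limits along
    the proper filter \<open>H\<close> are unique.\<close>
  interpret \<psi>: positive_functional \<psi>
  proof
    show "compact (UNIV :: 'x set)" by (rule compact_space)
    show "\<exists>d. continuous_on UNIV d \<and> (\<forall>x. (0::real) \<le> d x) \<and> U = {x. 0 < d x}"
      if "open U" for U :: "'x set"
      using metrizable_space_cozero[OF metr that] .
  next
    fix a b :: "'x \<Rightarrow> real" assume ab: "continuous_on UNIV a" "continuous_on UNIV b"
    have "((\<lambda>i. \<phi> i a + \<phi> i b) \<longlongrightarrow> \<psi> (\<lambda>x. a x + b x)) H"
      by (rule Lim_transform_eventually[OF lim])
        (use inI \<phi>_add ab in \<open>auto intro!: continuous_intros elim!: eventually_mono\<close>)
    then show "\<psi> (\<lambda>x. a x + b x) = \<psi> a + \<psi> b"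
      by (rule tendsto_unique[OF H(2) _ tendsto_add[OF lim[OF ab(1)] lim[OF ab(2)]]])
  next
    fix a :: "'x \<Rightarrow> real" and c assume a: "continuous_on UNIV a"
    have "((\<lambda>i. c * \<phi> i a) \<longlongrightarrow> \<psi> (\<lambda>x. c * a x)) H"
      using lim[OF continuous_on_mult_left[OF a, of c]] by (simp add: \<phi>_scale)
    then show "\<psi> (\<lambda>x. c * a x) = c * \<psi> a"
      by (rule tendsto_unique[OF H(2) _ tendsto_mult_left[OF lim[OF a]]])
  next
    fix a :: "'x \<Rightarrow> real" assume a: "continuous_on UNIV a" "\<And>x. 0 \<le> a x"
    show "0 \<le> \<psi> a"
      by (rule tendsto_lowerbound[OF lim[OF a(1)] _ H(2)])
        (use inI \<phi>_nonneg a in \<open>auto elim!: eventually_mono\<close>)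
  next
    have "((\<lambda>i. 1) \<longlongrightarrow> \<psi> (\<lambda>_. 1)) H"
      by (rule Lim_transform_eventually[OF lim]) (use inI \<phi>_one in \<open>auto elim!: eventually_mono\<close>)
    then show "\<psi> (\<lambda>_. 1) = 1"
      by (rule tendsto_unique[OF H(2) _ tendsto_const])
  qed
  \<comment> \<open>The Folner ratio also vanishes along the finer filter \<open>H\<close>, and
    \<open>B a\<close> times it bounds the failure of invariance of \<open>\<phi> i\<close> at
    \<open>a\<close>.\<close>
  have \<psi>_translate: "\<psi> (\<lambda>x. a (T g x)) = \<psi> a" if a: "continuous_on UNIV a" for a g
  proof -
    let ?r = "\<lambda>i. measure m (sym_diff ((+) g ` F i) (F i)) / measure m (F i)"
    have "(?r \<longlongrightarrow> 0) H" by (rule tendsto_mono[OF order_trans[OF H(1) G(2)] ratio])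
    then have maj: "((\<lambda>i. B a * ?r i) \<longlongrightarrow> 0) H" by (rule tendsto_mult_right_zero)
    have bd: "\<bar>a x\<bar> \<le> B a" for x using B a by simp
    have "eventually (\<lambda>i. norm (\<phi> i (\<lambda>x. a (T g x)) - \<phi> i a) \<le> B a * ?r i) H"
      using inI by eventually_elim (simp only: real_norm_def \<phi>_translate[OF _ a bd])
    then have "((\<lambda>i. \<phi> i (\<lambda>x. a (T g x)) - \<phi> i a) \<longlongrightarrow> 0) H"
      using maj by (rule Lim_null_comparison)
    moreover have "((\<lambda>i. \<phi> i (\<lambda>x. a (T g x)) - \<phi> i a) \<longlongrightarrow> \<psi> (\<lambda>x. a (T g x)) - \<psi> a) H"
      by (intro tendsto_diff lim continuous_on_orbit(3) a)
    ultimately have "0 = \<psi> (\<lambda>x. a (T g x)) - \<psi> a" by (rule tendsto_unique[OF H(2)])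
    then show ?thesis by simp
  qed
  have rep: "\<psi>.rep \<in> invariant_measures T"
    unfolding invariant_measures_def
  proof (intro CollectI conjI allI)
    show "prob_space \<psi>.rep" by (rule \<psi>.prob_space_rep)
    show "sets \<psi>.rep = sets borel" by simp
    fix g
    have Tg: "T g \<in> measurable \<psi>.rep borel" using T_borel by (simp cong: measurable_cong_sets)
    \<comment> \<open>Borel probability measures here are determined by integrals of continuous
      functions, so invariance of \<open>\<psi>\<close> suffices.\<close>
    show "distr \<psi>.rep borel (T g) = \<psi>.rep"
    proof (rule prob_measure_eqI_continuous)
      show "prob_space (distr \<psi>.rep borel (T g))"
        by (rule prob_space.prob_space_distr[OF \<psi>.prob_space_rep Tg])
      fix a :: "'x \<Rightarrow> real" assume a: "continuous_on UNIV a"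
      have "(\<integral>x. a x \<partial>distr \<psi>.rep borel (T g)) = (\<integral>x. a (T g x) \<partial>\<psi>.rep)"
        using Tg borel_measurable_continuous_onI[OF a] by (rule integral_distr)
      also have "\<dots> = (\<integral>x. a x \<partial>\<psi>.rep)"
        using a continuous_on_orbit(3)[OF a] by (simp add: \<psi>.integral_rep \<psi>_translate)
      finally show "(\<integral>x. a x \<partial>distr \<psi>.rep borel (T g)) = (\<integral>x. a x \<partial>\<psi>.rep)" .
    qed (use \<psi>.prob_space_rep \<psi>.cozero in auto)
  qed
  \<comment> \<open>\<open>\<psi>\<close> sees only real functions; convergence for complex
    \<open>f\<close> is recovered from its real and imaginary parts.\<close>
  have part: "((\<lambda>i. L (?\<Lambda> i)) \<longlongrightarrow> L (\<integral>x. f x \<partial>\<psi>.rep)) H" if L: "bounded_linear L" for L :: "complex \<Rightarrow> real"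
  proof -
    interpret L: bounded_linear L by (rule L)
    have Lf: "continuous_on UNIV (\<lambda>x. L (f x))" by (rule L.continuous_on[OF f])
    have "\<psi> (\<lambda>x. L (f x)) = L (\<integral>x. f x \<partial>\<psi>.rep)"
      using integral_bounded_linear[OF L integrable_invariant_measure[OF rep f]]
      by (simp add: \<psi>.integral_rep[OF Lf])
    moreover have "eventually (\<lambda>i. \<phi> i (\<lambda>x. L (f x)) = L (?\<Lambda> i)) H"
      using inI
    proof eventually_elim
      case (elim i)
      then show ?case
        unfolding \<phi>_def using bounded_linear_alpha_Avg[OF L f \<mu> C\<mu>(2) F(1)] by simp
    qed
    ultimately show ?thesis using Lim_transform_eventually[OF lim[OF Lf]] by simp
  qed
  have "(?\<Lambda> \<longlongrightarrow> (\<integral>x. f x \<partial>\<psi>.rep)) H"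
    using part[OF bounded_linear_Re] part[OF bounded_linear_Im] by (simp add: tendsto_complex_iff)
  moreover have "(\<integral>x. f x \<partial>\<psi>.rep) = (\<integral>x. f x \<partial>\<mu>)"
  proof -
    let ?V = "{(\<integral>x. f x \<partial>\<nu>) | \<nu>. \<nu> \<in> invariant_measures T}"
    obtain v where "?V = {v}" using herman unfolding herman_def is_singleton_def by blast
    moreover have "(\<integral>x. f x \<partial>\<psi>.rep) \<in> ?V" "(\<integral>x. f x \<partial>\<mu>) \<in> ?V" using rep \<mu> by blast+
    ultimately show ?thesis by simp
  qed
  \<comment> \<open>This contradicts \<open>H \<le> G\<close>, since \<open>G\<close> contains only
    indices at distance at least \<open>e\<close>.\<close>
  ultimately have "eventually (\<lambda>i. dist (?\<Lambda> i) (\<integral>x. f x \<partial>\<mu>) < e) H"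
    using e(1) by (simp add: tendstoD)
  then have "eventually (\<lambda>i. False) H"
    using filter_leD[OF H(1) G(3)] by eventually_elim simp
  with H(2) show False by (simp add: trivial_limit_def)
qed

end

theorem theorem1p13:
  fixes m :: "'g::{topological_group_add, t2_space} measure"
    and T :: "'g \<Rightarrow> 'x::topological_space \<Rightarrow> 'x"
    and \<mu> :: "'x measure"
    and I :: "'i set" and le :: "'i \<Rightarrow> 'i \<Rightarrow> bool"
    and F :: "'i \<Rightarrow> 'g set"
    and f :: "'x \<Rightarrow> complex"
  assumes "locally_compact_space (euclidean :: 'g topology)"
    and "unimodular TYPE('g)"
    and "amenable TYPE('g)"
    and "left_haar_measure m" and "right_haar_measure m"
    and "compact (UNIV :: 'x set)"
    and "metrizable_space (euclidean :: 'x topology)"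
    and "continuous_action T"
    and "\<mu> \<in> invariant_measures T"
    and "folner_net m I le F"
    and "continuous_on UNIV f"
  shows "(herman T f \<longrightarrow> averages_converge m T \<mu> I le F f (sets borel)) \<and>
         (averages_converge m T \<mu> I le F f (sets borel) \<longrightarrow>
            averages_converge m T \<mu> I le F f {U. open U}) \<and>
         (fully_supported \<mu> \<longrightarrow>
            averages_converge m T \<mu> I le F f {U. open U} \<longrightarrow> herman T f)"
proof -
  interpret compact_action m T using assms by unfold_locales
  \<comment> \<open>Open sets are Borel, so every net of open sets is already covered.\<close>
  have "averages_converge m T \<mu> I le F f {U. open U}"
    if "averages_converge m T \<mu> I le F f (sets borel)"
    using that by (auto simp: averages_converge_def)
  then show ?thesis
    using herman_imp_averages_converge averages_converge_open_imp_herman assms by blast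
qed

end
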